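(* Let $A\in\mathbb{S}^n_+$ and $B\in\mathbb{S}^n$. Then every eigenvalue of $A+tB$ is an analytic function of $t$ whose leading term has degree less than or equal to $2$. That is, the eigenvalues of $A+tB$, counted with multiplicity, are given by real analytic functions $\lambda_1(t),\ldots,\lambda_n(t)$ of the real variable $t$, and each $\lambda_i$ that is not identically zero has the form $\lambda_i(t)=\sigma t^{d}+O(t^{d+1})$ as $t\to0$ with $\sigma\neq0$ and $d\in\{0,1,2\}$.
   Context: $\mathbb{S}^n$ is the space of real symmetric $n\times n$ matrices and $\mathbb{S}^n_+$ is the set of positive semidefinite matrices in $\mathbb{S}^n$. The leading term of a nonzero analytic function of $t$ is the nonzero term of lowest degree in its power series expansion at $t=0$. *)

theory Defs
  imports
    "HOL-Analysis.FPS_Convergence"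
    "HOL-Library.Landau_Symbols"
    "Jordan_Normal_Form.Char_Poly"
begin

definition sym_mats :: "nat \<Rightarrow> real mat set" where
  "sym_mats n = {M \<in> carrier_mat n n. transpose_mat M = M}"

definition psd_mats :: "nat \<Rightarrow> real mat set" where
  "psd_mats n = {M \<in> sym_mats n. \<forall>v \<in> carrier_vec n. 0 \<le> v \<bullet> (M *\<^sub>v v)}"

text \<open>The values \<open>e 0, \<dots>, e (n - 1)\<close> are the eigenvalues of \<open>M\<close>, each listed as often as
  its multiplicity as a root of the characteristic polynomial.\<close>
definition eigenvalues_with_mult :: "nat \<Rightarrow> real mat \<Rightarrow> (nat \<Rightarrow> real) \<Rightarrow> bool" where
  "eigenvalues_with_mult n M e \<longleftrightarrow>
     {c. eigenvalue M c} = e ` {..<n} \<and> char_poly M = (\<Prod>i<n. [:- e i, 1:])"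

text \<open>Real analyticity on the whole real line: around each point \<open>x\<close> the function agrees with a
  power series in \<open>h\<close> of positive radius of convergence.\<close>
definition real_analytic :: "(real \<Rightarrow> real) \<Rightarrow> bool" where
  "real_analytic f \<longleftrightarrow> (\<forall>x. \<exists>F. (\<lambda>h. f (x + h)) has_fps_expansion F)"

text \<open>\<open>\<sigma> t\<^sup>d\<close> is the nonzero term of lowest degree in the expansion of \<open>f\<close> at \<open>0\<close>; the condition
  \<open>F \<noteq> 0\<close> is needed since \<open>subdegree 0 = 0\<close>.\<close>
definition has_leading_term :: "(real \<Rightarrow> real) \<Rightarrow> real \<Rightarrow> nat \<Rightarrow> bool" where
  "has_leading_term f \<sigma> d \<longleftrightarrow>
     (\<exists>F. f has_fps_expansion F \<and> F \<noteq> 0 \<and> subdegree F = d \<and> fps_nth F d = \<sigma>)"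

end

theory Submission
  imports Defs "HOL-Complex_Analysis.Laurent_Convergence"
begin

text \<open>
  The first part is Rellich's theorem for the line \<open>A + t B\<close>; it only uses that the
  characteristic polynomial \<open>p\<^sub>t\<close> has coefficients analytic in \<open>t\<close> and, by symmetry, only real
  roots for real \<open>t\<close>. Near a given parameter, say \<open>0\<close>, Puiseux's theorem (\<open>puiseux_root\<close>)
  describes a root as an analytic function \<open>g\<close> of \<open>s\<close> with \<open>s\<^sup>N = t\<close>. A genuinely ramified series
  cannot be real for all real \<open>t\<close> of both signs: \<open>g\<close> is real on the rays through \<open>1\<close> and through
  \<open>cis (\<pi> / N)\<close>, which leaves only the powers of \<open>s\<^sup>N\<close> (\<open>fps_coeff_zero_if_real_on_rays\<close>). So \<open>p\<^sub>t\<close> has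
  an analytic root, and after dividing by its linear factor one can continue; \<open>p\<^sub>t\<close>
  is locally a product of linear factors with analytic roots (\<open>analytic_splitting\<close>).

  An analytic root at one point can be continued along the whole line, because near any point
  it must coincide with one of the finitely many local roots (\<open>root_germ_continues\<close>). Continuing
  the \<open>n\<close> roots at \<open>0\<close> gives global functions, and the identity theorem propagates the
  factorisation from a neighbourhood of \<open>0\<close> to all \<open>t\<close> (\<open>global_analytic_splitting\<close>).

  The second part is a formal computation. The power series \<open>F\<close> of an eigenvalue is an eigenvalue of
  the matrix \<open>A + X B\<close> over formal power series, with an eigenvector \<open>v\<^sub>0 + v\<^sub>1 X + \<dots>\<close> that may be
  normalised so that \<open>v\<^sub>0 \<noteq> 0\<close>. If \<open>F\<close> vanished to order at least three, then positive
  semidefiniteness of \<open>A\<close> would force \<open>A v\<^sub>0 = B v\<^sub>0 = 0\<close>; but eigenvectors for a nonzero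
  eigenvalue are orthogonal to the common kernel of \<open>A\<close> and \<open>B\<close>
  (\<open>formal_eigenvalue_subdegree\<close>).
\<close>

section \<open>Simple roots of analytic families of polynomials\<close>

text \<open>The logarithmic derivative \<open>f' c / f c\<close> is the sum of \<open>1 / (c - z)\<close> over the roots \<open>z\<close> of \<open>f\<close>,
  so its modulus is at most \<open>degree f / \<rho>\<close>. Splitting off one root at a time
  gives the bound without dividing by \<open>f c\<close>.\<close>

lemma roots_far_imp_deriv_small:
  fixes f :: "complex poly"
  assumes "f \<noteq> 0" and "\<And>z. poly f z = 0 \<Longrightarrow> \<rho> \<le> dist c z"
  shows "\<rho> * norm (poly (pderiv f) c) \<le> real (degree f) * norm (poly f c)"
  using assms
proof (induction "degree f" arbitrary: f)
  case 0
  then show ?case by (auto simp: pderiv_eq_0_iff[THEN iffD2])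
next
  case (Suc m)
  have "\<not> constant (poly f)"
    by (metis Suc.hyps(2) constant_degree nat.simps(3))
  from Fundamental_Theorem_Algebra.fundamental_theorem_of_algebra[OF this] obtain z where z: "poly f z = 0" ..
  then obtain h where f: "f = [:-z, 1:] * h"
    using poly_eq_0_iff_dvd[of f z] by (auto simp: dvd_def)
  have h0: "h \<noteq> 0"
    using Suc.prems(1) f by auto
  have dh: "degree f = Suc (degree h)"
    using h0 unfolding f by (subst degree_mult_eq) auto
  have IH: "\<rho> * norm (poly (pderiv h) c) \<le> real (degree h) * norm (poly h c)"
    using Suc.hyps dh h0 Suc.prems(2) f by (intro Suc.hyps(1)) auto
  have \<rho>: "\<rho> \<le> norm (c - z)"
    using Suc.prems(2)[OF z] by (simp add: dist_norm)
  have e1: "poly (pderiv f) c = poly h c + (c - z) * poly (pderiv h) c"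
    unfolding f pderiv_mult by (simp add: pderiv_pCons algebra_simps)
  have e2: "poly f c = (c - z) * poly h c"
    unfolding f by (simp add: algebra_simps)
  show ?case
  proof (cases "\<rho> \<ge> 0")
    case True
    have "\<rho> * norm (poly (pderiv f) c)
        \<le> \<rho> * norm (poly h c) + norm (c - z) * (\<rho> * norm (poly (pderiv h) c))"
      using mult_left_mono[OF norm_triangle_ineq True, of "poly h c" "(c - z) * poly (pderiv h) c"]
      unfolding e1 norm_mult by (simp only: distrib_left ac_simps)
    also have "\<dots> \<le> norm (c - z) * norm (poly h c)
        + norm (c - z) * (real (degree h) * norm (poly h c))"
      by (intro add_mono mult_right_mono mult_left_mono \<rho> IH) auto
    also have "\<dots> = real (degree f) * norm (poly f c)"
      unfolding e2 dh norm_mult of_nat_Suc by (simp only: distrib_left distrib_right ac_simps mult_1_left mult_1_right)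
    finally show ?thesis .
  next
    case False
    then have "\<rho> * norm (poly (pderiv f) c) \<le> 0"
      by (simp add: mult_nonpos_nonneg)
    then show ?thesis
      by (rule order_trans) simp
  qed
qed

text \<open>This is how roots are found below: a family that almost vanishes at \<open>c\<close> and has a derivative
  bounded away from zero there has a genuine root near \<open>c\<close>, by the fundamental theorem of algebra
  alone. It yields both the existence and the continuity of a root depending on a parameter.\<close>

lemma root_near_almost_root:
  fixes f :: "complex poly"
  assumes "degree f \<le> n" and "real n * norm (poly f c) < \<epsilon> * norm (poly (pderiv f) c)"
  shows "\<exists>z. poly f z = 0 \<and> dist c z < \<epsilon>"
proof (rule ccontr)
  assume "\<not> ?thesis"
  moreover have "f \<noteq> 0"
    using assms(2) by auto
  ultimately have "\<epsilon> * norm (poly (pderiv f) c) \<le> real (degree f) * norm (poly f c)"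
    by (intro roots_far_imp_deriv_small) force+
  also have "\<dots> \<le> real n * norm (poly f c)"
    using assms(1) by (intro mult_right_mono) auto
  finally show False
    using assms(2) by simp
qed

text \<open>The quotient \<open>(f x - f y) / (x - y)\<close>, written as a polynomial in \<open>x\<close>, \<open>y\<close> and the coefficients
  of \<open>f\<close>, so that it is jointly continuous across the diagonal, where it becomes \<open>f' x\<close>.\<close>

definition divided_difference :: "nat \<Rightarrow> complex poly \<Rightarrow> complex \<Rightarrow> complex \<Rightarrow> complex" where
  "divided_difference n f x y = (\<Sum>j\<le>n. coeff f j * (\<Sum>i<j. y ^ (j - Suc i) * x ^ i))"

lemma poly_sum_upto:
  fixes f :: "'a :: comm_semiring_1 poly"
  assumes "degree f \<le> n"
  shows "poly f x = (\<Sum>j\<le>n. coeff f j * x ^ j)"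
proof -
  have "(\<Sum>j\<le>n. coeff f j * x ^ j) = (\<Sum>j\<le>degree f. coeff f j * x ^ j)"
    using assms by (intro sum.mono_neutral_right) (auto simp: coeff_eq_0)
  then show ?thesis
    by (simp add: Polynomial.poly_altdef)
qed

lemma poly_diff_eq_divided_difference:
  assumes "degree f \<le> n"
  shows "poly f x - poly f y = (x - y) * divided_difference n f x y"
  unfolding divided_difference_def poly_sum_upto[OF assms] sum_distrib_left
    sum_subtractf[symmetric]
  by (intro sum.cong) (simp_all add: power_diff_sumr2 sum_distrib_left algebra_simps flip: right_diff_distrib)

lemma divided_difference_diag:
  assumes "degree f \<le> n"
  shows "divided_difference n f x x = poly (pderiv f) x"
proof -
  have "poly (pderiv f) x = (\<Sum>j\<le>n. poly (pderiv (monom (coeff f j) j)) x)"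
    by (subst (1) poly_as_sum_of_monoms'[OF assms, symmetric])
      (simp add: pderiv_sum poly_sum)
  also have "\<dots> = divided_difference n f x x"
    unfolding divided_difference_def
    by (intro sum.cong) (auto simp: pderiv_monom poly_monom simp flip: power_add)
  finally show ?thesis ..
qed

text \<open>Only the degree bound is uniform in \<open>t\<close>. The coefficient of \<open>x\<^sup>n\<close> may vanish at \<open>t = 0\<close>: this
  happens for the rescaled families in the proof of Puiseux's theorem, whose value at \<open>0\<close> has
  lower degree.\<close>

definition analytic_family :: "nat \<Rightarrow> (complex \<Rightarrow> complex poly) \<Rightarrow> bool" where
  "analytic_family n p \<longleftrightarrow>
     (\<forall>t. degree (p t) \<le> n) \<and> (\<forall>j. (\<lambda>t. coeff (p t) j) analytic_on {0})"

lemma analytic_family_degree: "analytic_family n p \<Longrightarrow> degree (p t) \<le> n"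
  by (simp add: analytic_family_def)

lemma analytic_family_coeff: "analytic_family n p \<Longrightarrow> (\<lambda>t. coeff (p t) j) analytic_on {0}"
  by (simp add: analytic_family_def)

lemma analytic_at_common_ball:
  fixes f :: "'i \<Rightarrow> complex \<Rightarrow> complex"
  assumes "finite I" and "\<And>i. i \<in> I \<Longrightarrow> f i analytic_on {z}"
  shows "\<exists>\<delta>>0. \<forall>i\<in>I. f i holomorphic_on ball z \<delta>"
  using assms
proof (induction I)
  case empty
  then show ?case by (auto intro: exI[of _ 1])
next
  case (insert i I)
  then obtain d where d: "d > 0" "\<forall>i\<in>I. f i holomorphic_on ball z d"
    by auto
  obtain e where e: "e > 0" "f i holomorphic_on ball z e"
    using insert.prems[of i] unfolding analytic_on_def by auto
  have "min d e > 0 \<and> (\<forall>j\<in>insert i I. f j holomorphic_on ball z (min d e))"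
  proof (intro conjI ballI)
    fix j assume j: "j \<in> insert i I"
    have "ball z (min d e) \<subseteq> ball z d" "ball z (min d e) \<subseteq> ball z e"
      by auto
    then show "f j holomorphic_on ball z (min d e)"
      using j d(2) e(2) by (metis holomorphic_on_subset insertE)
  qed (use d e in auto)
  then show ?case by blast
qed

text \<open>The holomorphic implicit function theorem for polynomial equations. At a simple root the divided
  difference is nonzero, hence it stays nonzero nearby, so that nearby polynomials have at most one
  root near \<open>c\<close>; \<open>root_near_almost_root\<close> provides one. The root is then continuous in \<open>t\<close>, and dividing
  \<open>p\<^sub>t (g t) - p\<^sub>t (g s) = (g t - g s) D\<close> by \<open>(t - s) D\<close> shows that it is
  differentiable.\<close>

lemma simple_root_continues:
  assumes fam: "analytic_family n p"
    and root: "poly (p 0) c = 0" and simple: "poly (pderiv (p 0)) c \<noteq> 0"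
  shows "\<exists>g. g analytic_on {0} \<and> g 0 = c \<and> (\<forall>\<^sub>F t in nhds 0. poly (p t) (g t) = 0)"
proof -
  note deg = analytic_family_degree[OF fam]
  define D where "D = (\<lambda>t. divided_difference n (p t))"
  obtain \<delta>0 where \<delta>0: "\<delta>0 > 0" and hol: "\<And>j. j \<le> n \<Longrightarrow> (\<lambda>t. coeff (p t) j) holomorphic_on ball 0 \<delta>0"
    using analytic_at_common_ball[of "{..n}" "\<lambda>j t. coeff (p t) j" 0] analytic_family_coeff[OF fam] by auto
  have coeff_lim: "(\<lambda>t. coeff (p t) j) \<midarrow>s\<rightarrow> coeff (p s) j" if "j \<le> n" "s \<in> ball 0 \<delta>0" for j s
  proof -
    have "continuous_on (ball 0 \<delta>0) (\<lambda>t. coeff (p t) j)"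
      by (rule holomorphic_on_imp_continuous_on[OF hol[OF that(1)]])
    then have "isCont (\<lambda>t. coeff (p t) j) s"
      using that(2) continuous_on_interior interior_open open_ball by metis
    then show ?thesis
      by (rule isContD)
  qed
  have coeff_lim': "((\<lambda>w. coeff (p (fst w)) j) \<longlongrightarrow> coeff (p s) j) (nhds (s, x))"
    if "j \<le> n" "s \<in> ball 0 \<delta>0" for j s and x :: "complex \<times> complex"
  proof -
    have "((\<lambda>t. coeff (p t) j) \<longlongrightarrow> coeff (p s) j) (nhds s)"
      using coeff_lim[OF that] by (simp add: tendsto_nhds_iff)
    moreover have "filterlim fst (nhds s) (nhds (s, x))"
      using tendsto_fst[OF filterlim_ident[of "nhds (s, x)"]] by simp
    ultimately show ?thesis
      by (rule filterlim_compose)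
  qed
  have D_lim: "((\<lambda>w. D (fst w) (fst (snd w)) (snd (snd w))) \<longlongrightarrow> D s x y) (nhds (s, x, y))"
    if "s \<in> ball 0 \<delta>0" for s x y
  proof -
    have 1: "((\<lambda>w. fst (snd w)) \<longlongrightarrow> x) (nhds (s, x, y))"
      using tendsto_fst[OF tendsto_snd[OF filterlim_ident[of "nhds (s, x, y)"]]] by simp
    have 2: "((\<lambda>w. snd (snd w)) \<longlongrightarrow> y) (nhds (s, x, y))"
      using tendsto_snd[OF tendsto_snd[OF filterlim_ident[of "nhds (s, x, y)"]]] by simp
    show ?thesis
      unfolding D_def divided_difference_def
      by (intro tendsto_intros coeff_lim' that 1 2) auto
  qed
  have "D 0 c c \<noteq> 0"
    using simple by (simp add: D_def divided_difference_diag[OF deg])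
  then have "\<forall>\<^sub>F w in nhds (0, c, c). D (fst w) (fst (snd w)) (snd (snd w)) \<noteq> 0"
    using D_lim[of 0 c c] \<delta>0 by (intro tendsto_imp_eventually_ne) auto
  then obtain S where S: "open S" "(0, c, c) \<in> S"
      "\<And>w. w \<in> S \<Longrightarrow> D (fst w) (fst (snd w)) (snd (snd w)) \<noteq> 0"
    unfolding eventually_nhds by blast
  obtain A B where AB: "open A" "open B" "0 \<in> A" "(c, c) \<in> B" "A \<times> B \<subseteq> S"
    using S(1,2) by (metis open_prod_elim mem_Sigma_iff)
  obtain B1 B2 where BB: "open B1" "open B2" "c \<in> B1" "c \<in> B2" "B1 \<times> B2 \<subseteq> B"
    using AB(2,4) by (metis open_prod_elim mem_Sigma_iff)
  obtain \<epsilon> where \<epsilon>: "\<epsilon> > 0" "ball c \<epsilon> \<subseteq> B1 \<inter> B2"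
    using BB by (metis IntI open_Int open_contains_ball)
  have D_nz: "D t x y \<noteq> 0" if "t \<in> A" "x \<in> ball c \<epsilon>" "y \<in> ball c \<epsilon>" for t x y
  proof -
    have "(x, y) \<in> B"
      using BB(5) \<epsilon>(2) that(2,3) by blast
    then have "(t, x, y) \<in> S"
      using AB(5) that(1) by blast
    from S(3)[OF this] show ?thesis by simp
  qed
  have uniq: "x = y" if "t \<in> A" "x \<in> ball c \<epsilon>" "y \<in> ball c \<epsilon>" "poly (p t) x = 0" "poly (p t) y = 0"
    for t x y
    using poly_diff_eq_divided_difference[OF deg[of t], of x y] D_nz[OF that(1-3)] that(4,5)
    by (auto simp: D_def)
  \<comment> \<open>Existence is needed at every base point \<open>s\<close>, not only at \<open>0\<close>: together with uniqueness it gives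
    continuity of the root function at \<open>s\<close>.\<close>
  have near: "\<forall>\<^sub>F t in nhds s. \<exists>z. poly (p t) z = 0 \<and> dist x z < e"
    if s: "s \<in> ball 0 \<delta>0" and x: "poly (p s) x = 0" "poly (pderiv (p s)) x \<noteq> 0" and "e > 0" for s x e
  proof -
    have p_lim: "((\<lambda>t. poly (p t) x) \<longlongrightarrow> poly (p s) x) (nhds s)"
      unfolding poly_sum_upto[OF deg]
      by (intro tendsto_intros) (use coeff_lim[OF _ s] in \<open>auto simp: tendsto_nhds_iff\<close>)
    have d_lim: "((\<lambda>t. poly (pderiv (p t)) x) \<longlongrightarrow> poly (pderiv (p s)) x) (nhds s)"
      unfolding divided_difference_diag[OF deg, symmetric] divided_difference_def
      by (intro tendsto_intros) (use coeff_lim[OF _ s] in \<open>auto simp: tendsto_nhds_iff\<close>)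
    have "((\<lambda>t. real n * norm (poly (p t) x) - e * norm (poly (pderiv (p t)) x))
        \<longlongrightarrow> real n * norm (poly (p s) x) - e * norm (poly (pderiv (p s)) x)) (nhds s)"
      by (intro tendsto_intros p_lim d_lim)
    moreover have "real n * norm (poly (p s) x) - e * norm (poly (pderiv (p s)) x) < 0"
      using x \<open>e > 0\<close> by simp
    ultimately have "\<forall>\<^sub>F t in nhds s. real n * norm (poly (p t) x) - e * norm (poly (pderiv (p t)) x) < 0"
      by (rule order_tendstoD)
    then show ?thesis
      by eventually_elim (rule root_near_almost_root[OF deg], simp)
  qed
  have "\<forall>\<^sub>F t in nhds 0. (\<exists>z. poly (p t) z = 0 \<and> dist c z < \<epsilon>) \<and> t \<in> A \<and> t \<in> ball 0 \<delta>0"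
    using near[of 0 c \<epsilon>] \<delta>0 root simple \<epsilon>(1) AB(1,3)
    by (intro eventually_conj eventually_nhds_in_open) auto
  then obtain \<delta> where \<delta>: "\<delta> > 0" and all: "\<forall>t. dist t 0 < \<delta> \<longrightarrow>
      (\<exists>z. poly (p t) z = 0 \<and> dist c z < \<epsilon>) \<and> t \<in> A \<and> t \<in> ball 0 \<delta>0"
    unfolding eventually_nhds_metric by auto
  have ex: "\<exists>z. poly (p t) z = 0 \<and> dist c z < \<epsilon>" if "t \<in> ball 0 \<delta>" for t
    using all that by (simp add: dist_commute)
  have sub: "ball 0 \<delta> \<subseteq> A" "ball 0 \<delta> \<subseteq> (ball 0 \<delta>0 :: complex set)"
  proof -
    have "t \<in> A \<and> t \<in> ball 0 \<delta>0" if "t \<in> ball 0 \<delta>" for t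
      using all that by (simp add: dist_commute)
    then show "ball 0 \<delta> \<subseteq> A" "ball 0 \<delta> \<subseteq> (ball 0 \<delta>0 :: complex set)"
      by blast+
  qed
  define g where "g = (\<lambda>t. SOME z. poly (p t) z = 0 \<and> dist c z < \<epsilon>)"
  have g: "poly (p t) (g t) = 0 \<and> g t \<in> ball c \<epsilon>" if "t \<in> ball 0 \<delta>" for t
    using someI_ex[OF ex[OF that]] by (simp add: g_def)
  have g0: "g 0 = c"
    using uniq[of 0 "g 0" c] g[of 0] \<delta> AB(3) \<epsilon>(1) root by auto
  have g_cont: "(g \<longlongrightarrow> g s) (at s)" if s: "s \<in> ball 0 \<delta>" for s
  proof (rule tendstoI)
    fix e :: real assume "e > 0"
    obtain e' where e': "e' > 0" "ball (g s) e' \<subseteq> ball c \<epsilon>"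
      using open_contains_ball_eq[OF open_ball, of "g s" c \<epsilon>] g[OF s] by blast
    have "poly (pderiv (p s)) (g s) \<noteq> 0"
      using D_nz[of s "g s" "g s"] sub g[OF s] s by (auto simp: D_def divided_difference_diag[OF deg])
    then have "\<forall>\<^sub>F t in nhds s. \<exists>z. poly (p t) z = 0 \<and> dist (g s) z < min e e'"
      using s sub g[OF s] \<open>e > 0\<close> \<open>e' > 0\<close> by (intro near) auto
    moreover have "\<forall>\<^sub>F t in nhds s. t \<in> ball 0 \<delta>"
      using s by (intro eventually_nhds_in_open) auto
    ultimately have "\<forall>\<^sub>F t in nhds s. dist (g t) (g s) < e"
    proof eventually_elim
      case (elim t)
      then obtain z where z: "poly (p t) z = 0" "dist (g s) z < min e e'" by blast
      have "z = g t"
        by (rule uniq[of t]) (use z e' g[OF elim(2)] sub elim(2) in auto)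
      then show ?case
        using z by (simp add: dist_commute)
    qed
    then show "\<forall>\<^sub>F t in at s. dist (g t) (g s) < e"
      unfolding eventually_at_filter by eventually_elim simp
  qed
  have "g field_differentiable at s" if s: "s \<in> ball 0 \<delta>" for s
  proof -
    have "\<exists>E. ((\<lambda>t. poly (p t) (g s)) has_field_derivative E) (at s)"
    proof -
      have "(\<lambda>t. poly (p t) (g s)) holomorphic_on ball 0 \<delta>0"
        unfolding poly_sum_upto[OF deg]
        by (intro holomorphic_on_sum holomorphic_on_mult holomorphic_on_const hol) simp
      then have "(\<lambda>t. poly (p t) (g s)) field_differentiable at s"
        using holomorphic_on_imp_differentiable_at[OF _ open_ball] s sub by blast
      then show ?thesis
        by (simp add: field_differentiable_def)
    qed
    then obtain E where "((\<lambda>t. poly (p t) (g s)) has_field_derivative E) (at s)" ..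
    then have R: "((\<lambda>t. (poly (p t) (g s) - poly (p s) (g s)) / (t - s)) \<longlongrightarrow> E) (at s)"
      by (simp add: has_field_derivative_iff)
    have DD: "((\<lambda>t. D t (g t) (g s)) \<longlongrightarrow> D s (g s) (g s)) (at s)"
    proof -
      have "((\<lambda>t. (t, g t, g s)) \<longlongrightarrow> (s, g s, g s)) (at s)"
        by (intro tendsto_intros g_cont s)
      from filterlim_compose[OF D_lim this] show ?thesis
        using s sub by auto
    qed
    have nz: "D s (g s) (g s) \<noteq> 0"
      using D_nz s sub g[OF s] by auto
    have L1: "((\<lambda>t. - ((poly (p t) (g s) - poly (p s) (g s)) / (t - s)) / D t (g t) (g s))
        \<longlongrightarrow> - E / D s (g s) (g s)) (at s)"
      by (intro tendsto_intros R DD nz)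
    have L2: "\<forall>\<^sub>F t in at s. - ((poly (p t) (g s) - poly (p s) (g s)) / (t - s)) / D t (g t) (g s)
        = (g t - g s) / (t - s)"
    proof -
      have "\<forall>\<^sub>F t in at s. t \<in> ball 0 \<delta>"
        using s eventually_at_in_open'[of "ball 0 \<delta>" s] by auto
      moreover have "\<forall>\<^sub>F t in at s. t \<noteq> s"
        by (simp add: eventually_at_filter)
      ultimately show ?thesis
      proof eventually_elim
        case (elim t)
        have "poly (p t) (g t) - poly (p t) (g s) = (g t - g s) * D t (g t) (g s)"
          unfolding D_def by (rule poly_diff_eq_divided_difference[OF deg])
        moreover have "D t (g t) (g s) \<noteq> 0"
          using D_nz elim sub g[OF elim(1)] g[OF s] by auto
        moreover have "- ((poly (p t) (g s) - poly (p s) (g s)) / (t - s)) / D t (g t) (g s)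
            = (poly (p t) (g t) - poly (p t) (g s)) / (t - s) / D t (g t) (g s)"
          using g[OF elim(1)] g[OF s] by simp
        ultimately show ?case
          by simp
      qed
    qed
    have "(g has_field_derivative - E / D s (g s) (g s)) (at s)"
      unfolding has_field_derivative_iff by (fact Lim_transform_eventually[OF L1 L2])
    then show ?thesis
      unfolding field_differentiable_def by blast
  qed
  then have "g holomorphic_on ball 0 \<delta>"
    by (simp add: holomorphic_on_def field_differentiable_at_within)
  then have an: "g analytic_on {0}"
    unfolding analytic_at_ball using \<delta> by blast
  have "\<forall>\<^sub>F t in nhds 0. t \<in> ball (0 :: complex) \<delta>"
    by (rule eventually_nhds_in_open) (use \<delta> in auto)
  then have rt: "\<forall>\<^sub>F t in nhds 0. poly (p t) (g t) = 0"
    by eventually_elim (use g in blast)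
  show ?thesis
    by (rule exI[of _ g]) (simp only: an g0 rt simp_thms)
qed

section \<open>Puiseux's theorem for one root\<close>

lemma coeff_pcompose_linear:
  fixes f :: "complex poly"
  assumes "degree f \<le> n"
  shows "coeff (pcompose f [:m, 1:]) j = (\<Sum>i\<in>{j..n}. coeff f i * (of_nat (i choose j) * m ^ (i - j)))"
proof -
  have mon: "pcompose (monom a i) q = Polynomial.smult a (q ^ i)" for a :: complex and i q
    by (induction i) (simp_all add: monom_0 monom_Suc pcompose_pCons pcompose_smult)
  have deg: "degree ([:m, 1:] ^ i) = i" for i
    by (simp add: degree_linear_power)
  have "coeff (pcompose f [:m, 1:]) j = (\<Sum>i\<le>n. coeff f i * coeff ([:m, 1:] ^ i) j)"
    by (subst (1) poly_as_sum_of_monoms'[OF assms, symmetric])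
      (simp add: pcompose_sum mon coeff_sum)
  also have "\<dots> = (\<Sum>i\<in>{j..n}. coeff f i * coeff ([:m, 1:] ^ i) j)"
    by (intro sum.mono_neutral_right) (auto simp: coeff_eq_0 deg)
  also have "\<dots> = (\<Sum>i\<in>{j..n}. coeff f i * (of_nat (i choose j) * m ^ (i - j)))"
    by (intro sum.cong) (auto simp: coeff_linear_poly_power)
  finally show ?thesis .
qed

lemma analytic_family_shift:
  assumes "analytic_family n p" and "m analytic_on {0}"
  shows "analytic_family n (\<lambda>t. pcompose (p t) [:m t, 1:])"
proof -
  note deg = analytic_family_degree[OF assms(1)]
  have "degree (pcompose (p t) [:m t, 1:]) \<le> n" for t
    using deg[of t] by (simp add: degree_pcompose)
  moreover have "(\<lambda>t. coeff (pcompose (p t) [:m t, 1:]) j) analytic_on {0}" for j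
    unfolding coeff_pcompose_linear[OF deg]
    by (intro analytic_on_sum analytic_on_mult analytic_on_const analytic_on_power
        assms(2) analytic_family_coeff[OF assms(1)])
  ultimately show ?thesis
    by (simp add: analytic_family_def)
qed

lemma analytic_family_higher_pderiv:
  assumes "analytic_family n p"
  shows "analytic_family n (\<lambda>t. (pderiv ^^ m) (p t))"
proof -
  have "degree ((pderiv ^^ m) (p t)) \<le> n" for t
    using analytic_family_degree[OF assms, of t] by (simp add: degree_higher_pderiv)
  moreover have "(\<lambda>t. coeff ((pderiv ^^ m) (p t)) j) analytic_on {0}" for j
    unfolding coeff_higher_pderiv
    by (intro analytic_on_mult analytic_on_const analytic_family_coeff[OF assms])
  ultimately show ?thesis
    by (simp add: analytic_family_def)
qed

lemma poly_higher_pderiv_eq_shift_coeff: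
  fixes f :: "complex poly"
  shows "poly ((pderiv ^^ m) f) c = fact m * coeff (pcompose f [:c, 1:]) m"
proof -
  have "(pderiv ^^ m) (pcompose f [:c, 1:]) = pcompose ((pderiv ^^ m) f) [:c, 1:]"
    by (induction m) (simp_all add: pderiv_pcompose pderiv_pCons)
  then have "poly ((pderiv ^^ m) f) c = coeff ((pderiv ^^ m) (pcompose f [:c, 1:])) 0"
    by (simp add: poly_pcompose flip: poly_0_coeff_0)
  then show ?thesis
    by (simp add: coeff_higher_pderiv pochhammer_fact)
qed

lemma shift_coeffs_at_root:
  fixes f :: "complex poly"
  assumes "f \<noteq> 0"
  shows "j < order c f \<Longrightarrow> coeff (pcompose f [:c, 1:]) j = 0"
    and "coeff (pcompose f [:c, 1:]) (order c f) \<noteq> 0"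
proof -
  obtain q where q: "f = [:-c, 1:] ^ order c f * q" "\<not> [:-c, 1:] dvd q"
    using order_decomp[OF assms] by blast
  have pow: "pcompose ([:-c, 1:] ^ k) [:c, 1:] = monom 1 k" for k
  proof (induction k)
    case 0
    then show ?case by (simp add: pcompose_1 flip: one_pCons)
  next
    case (Suc k)
    then show ?case
      by (simp only: power_Suc pcompose_mult) (simp add: pcompose_pCons monom_Suc)
  qed
  have "pcompose f [:c, 1:] = monom 1 (order c f) * pcompose q [:c, 1:]"
    by (subst q(1)) (simp only: pcompose_mult pow)
  then have co: "coeff (pcompose f [:c, 1:]) j
      = (if j < order c f then 0 else coeff (pcompose q [:c, 1:]) (j - order c f))" for j
    by (simp add: coeff_monom_mult)
  show "j < order c f \<Longrightarrow> coeff (pcompose f [:c, 1:]) j = 0"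
    by (simp add: co)
  have "coeff (pcompose q [:c, 1:]) 0 = poly q c"
    by (simp add: poly_pcompose flip: poly_0_coeff_0)
  then show "coeff (pcompose f [:c, 1:]) (order c f) \<noteq> 0"
    using q(2) by (simp add: co poly_eq_0_iff_dvd)
qed

lemma analytic_order_factorization:
  assumes "a analytic_on {0}" and "\<not> (\<forall>\<^sub>F t in nhds 0. a t = (0 :: complex))"
  shows "\<exists>d b. b analytic_on {0} \<and> b 0 \<noteq> 0 \<and> (\<forall>t. a t = t ^ d * b t)"
proof -
  obtain F where F: "a has_fps_expansion F"
    using analytic_at_imp_has_fps_expansion_0[OF assms(1)] by blast
  have "F \<noteq> 0"
    using F assms(2) has_fps_expansion_0_iff by auto
  define d where "d = subdegree F"
  define b where "b = (\<lambda>t. if t = 0 then fps_nth F d else a t / t ^ d)"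
  have "b has_fps_expansion fps_shift d F"
    unfolding b_def by (rule has_fps_expansion_shift[OF F]) (simp_all add: d_def)
  then have "b analytic_on {0}"
    by (rule has_fps_expansion_imp_analytic_0)
  moreover have "b 0 \<noteq> 0"
    using \<open>F \<noteq> 0\<close> by (simp add: b_def d_def)
  moreover have "a t = t ^ d * b t" for t
  proof (cases "t = 0")
    case True
    have "a 0 = fps_nth F 0"
      using has_fps_expansion_imp_0_eq_fps_nth_0[OF F] by simp
    moreover have "fps_nth F 0 = 0 ^ d * fps_nth F d"
      using nth_less_subdegree_zero[of 0 F] by (cases "d = 0") (auto simp: zero_power simp flip: d_def)
    ultimately show ?thesis
      using True by (simp add: b_def)
  qed (simp add: b_def)
  ultimately show ?thesis
    by blast
qed

lemma filterlim_power_nhds_0: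
  assumes "N > 0"
  shows "filterlim (\<lambda>s :: complex. s ^ N) (nhds 0) (nhds 0)"
proof -
  have "((\<lambda>s :: complex. s ^ N) \<longlongrightarrow> 0 ^ N) (nhds 0)"
    by (intro tendsto_intros filterlim_ident)
  then show ?thesis
    by (simp only: zero_power[OF assms])
qed

lemma analytic_on_compose_power:
  assumes "a analytic_on {0}" and "N > 0"
  shows "(\<lambda>s :: complex. a (s ^ N)) analytic_on {0}"
proof -
  have "(\<lambda>s. s ^ N) analytic_on {0}"
    by (intro analytic_intros)
  then have "(a \<circ> (\<lambda>s. s ^ N)) analytic_on {0}"
    by (rule analytic_on_compose) (use assms in \<open>simp add: zero_power\<close>)
  then show ?thesis
    by (simp add: o_def)
qed

text \<open>A root of full multiplicity forces \<open>f = a (x - z)\<^bsup>k + 1\<^esup>\<close>, whose coefficient of \<open>x\<^sup>k\<close> is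
  \<open>- a (k + 1) z\<close>. So \<open>z = 0\<close> and \<open>f\<close> is a monomial, which a second nonzero coefficient
  excludes.\<close>

lemma order_less_if_no_subleading:
  fixes f :: "complex poly"
  assumes "degree f = Suc k" and "coeff f k = 0" and "j \<le> k" and "coeff f j \<noteq> 0"
  shows "order z f < Suc k"
proof (rule ccontr)
  assume far: "\<not> order z f < Suc k"
  have "f \<noteq> 0"
    using assms(1) by auto
  then have ord: "order z f = Suc k"
    using far order_degree[of f z] assms(1) by simp
  obtain q where q: "f = [:-z, 1:] ^ Suc k * q"
    using order_1[of z f] ord by (auto simp: dvd_def)
  have "q \<noteq> 0"
    using q \<open>f \<noteq> 0\<close> by auto
  then have "degree f = Suc k + degree q"
    by (subst q, subst degree_mult_eq) (simp_all only: power_not_zero degree_linear_power pCons_eq_0_iff one_neq_zero simp_thms)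
  then obtain a where a: "q = [:a:]"
    using assms(1) degree_eq_zeroE by auto
  then have f: "f = Polynomial.smult a ([:-z, 1:] ^ Suc k)"
    using q by simp
  have "coeff f k = a * (of_nat (Suc k) * (- z))"
    unfolding f coeff_smult by (subst coeff_linear_poly_power) simp_all
  then have "z = 0"
    using assms(2) \<open>q \<noteq> 0\<close> a by (simp del: of_nat_Suc)
  then have "f = Polynomial.smult a (monom 1 (Suc k))"
    unfolding f by (simp only: monom_altdef) simp
  then show False
    using assms(3,4) by simp
qed

text \<open>The induction is on the multiplicity \<open>k\<close> of the root \<open>c\<close> of \<open>p\<^sub>0\<close>. The derivative of order
  \<open>k - 1\<close> has a simple root at \<open>c\<close>, which continues to an analytic function \<open>\<mu>\<close>. After the substitution
  \<open>x = \<mu> t + y\<close> the coefficient of \<open>y\<^bsup>k - 1\<^esup>\<close> vanishes identically. Rescaling by the least slope of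
  the Newton polygon, \<open>t = s\<^sup>q\<close> and \<open>y = s\<^sup>e y'\<close>, produces a family whose value at \<open>0\<close> has degree \<open>k\<close>,
  no term of degree \<open>k - 1\<close>, and a nonzero coefficient of lower degree. By
  \<open>order_less_if_no_subleading\<close> all of its roots have multiplicity less than \<open>k\<close>.
  For \<open>k = 1\<close> the root \<open>\<mu>\<close> is already a root of the family.\<close>

lemma puiseux_root:
  assumes "analytic_family n p" and "p 0 \<noteq> 0" and "poly (p 0) c = 0"
  shows "\<exists>N g. N > 0 \<and> g analytic_on {0} \<and> g 0 = c \<and> (\<forall>\<^sub>F s in nhds 0. poly (p (s ^ N)) (g s) = 0)"
  using assms
proof (induction "order c (p 0)" arbitrary: p c rule: less_induct)
  case less
  note fam = less.prems(1)
  define k where "k = order c (p 0)"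
  have "k > 0"
    using less.prems(2,3) by (simp add: k_def order_root)
  obtain \<mu> where \<mu>: "\<mu> analytic_on {0}" "\<mu> 0 = c"
    and \<mu>_root: "\<forall>\<^sub>F t in nhds 0. poly ((pderiv ^^ (k - 1)) (p t)) (\<mu> t) = 0"
  proof -
    have "poly ((pderiv ^^ (k - 1)) (p 0)) c = 0"
      using shift_coeffs_at_root(1)[OF less.prems(2), of "k - 1" c] \<open>k > 0\<close>
      by (simp add: poly_higher_pderiv_eq_shift_coeff k_def)
    moreover have "poly (pderiv ((pderiv ^^ (k - 1)) (p 0))) c \<noteq> 0"
    proof -
      have "pderiv ((pderiv ^^ (k - 1)) (p 0)) = (pderiv ^^ k) (p 0)"
        using \<open>k > 0\<close> by (metis Suc_pred' comp_apply funpow.simps(2))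
      then show ?thesis
        using shift_coeffs_at_root(2)[OF less.prems(2), of c]
        by (simp add: poly_higher_pderiv_eq_shift_coeff k_def)
    qed
    ultimately show thesis
      using simple_root_continues[OF analytic_family_higher_pderiv[OF fam, of "k - 1"]] that by blast
  qed
  define G where "G = (\<lambda>t. pcompose (p t) [:\<mu> t, 1:])"
  define a where "a = (\<lambda>j t. coeff (G t) j)"
  have G_fam: "analytic_family n G"
    unfolding G_def by (rule analytic_family_shift[OF fam \<mu>(1)])
  have a_an: "a j analytic_on {0}" for j
    using analytic_family_coeff[OF G_fam, of j] by (simp add: a_def)
  have poly_G: "poly (G t) x = poly (p t) (\<mu> t + x)" for t x
    by (simp add: G_def poly_pcompose)
  have a_low: "a j 0 = 0" if "j < k" for j
    using shift_coeffs_at_root(1)[OF less.prems(2)] that by (simp add: a_def G_def \<mu>(2) k_def)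
  have a_k: "a k 0 \<noteq> 0"
    using shift_coeffs_at_root(2)[OF less.prems(2)] by (simp add: a_def G_def \<mu>(2) k_def)
  have a_centred: "\<forall>\<^sub>F t in nhds 0. a (k - 1) t = 0"
    using \<mu>_root by eventually_elim (simp add: poly_higher_pderiv_eq_shift_coeff a_def G_def)
  have "k \<le> n"
    using order_degree[OF less.prems(2), of c] analytic_family_degree[OF fam, of 0] by (simp add: k_def)
  show ?case
  proof (cases "\<forall>\<^sub>F t in nhds 0. a 0 t = 0")
    case True
    have \<mu>1: "\<forall>\<^sub>F t in nhds 0. poly (p (t ^ 1)) (\<mu> t) = 0"
      using True
    proof eventually_elim
      case (elim t)
      then show ?case
        using poly_G[of t 0] by (simp add: a_def poly_0_coeff_0)
    qed
    show ?thesis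
      by (rule exI[of _ "1 :: nat"], rule exI[of _ \<mu>]) (simp only: \<mu> \<mu>1 zero_less_one simp_thms)
  next
    case False
    \<comment> \<open>The points of the Newton polygon: \<open>a j\<close> vanishes to order \<open>d j\<close> at \<open>0\<close>.\<close>
    define J where "J = {j. j < k \<and> \<not> (\<forall>\<^sub>F t in nhds 0. a j t = 0)}"
    have J: "finite J" "0 \<in> J" "k - 1 \<notin> J"
      using False \<open>k > 0\<close> a_centred by (auto simp: J_def)
    have "\<forall>j\<in>J. \<exists>d b. b analytic_on {0} \<and> b 0 \<noteq> 0 \<and> (\<forall>t. a j t = t ^ d * b t)"
      using analytic_order_factorization[OF a_an] by (simp add: J_def)
    from bchoice[OF this] obtain d where
      "\<forall>j\<in>J. \<exists>b. b analytic_on {0} \<and> b 0 \<noteq> 0 \<and> (\<forall>t. a j t = t ^ d j * b t)" ..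
    from bchoice[OF this] obtain b where
      "\<forall>j\<in>J. b j analytic_on {0} \<and> b j 0 \<noteq> 0 \<and> (\<forall>t. a j t = t ^ d j * b j t)" ..
    then have db: "\<And>j. j \<in> J \<Longrightarrow> b j analytic_on {0}" "\<And>j. j \<in> J \<Longrightarrow> b j 0 \<noteq> 0"
        "\<And>j t. j \<in> J \<Longrightarrow> a j t = t ^ d j * b j t"
      by simp_all
    have d_pos: "d j > 0" if "j \<in> J" for j
    proof (rule ccontr)
      assume "\<not> d j > 0"
      then have "a j 0 \<noteq> 0"
        using db(2,3)[OF that] by simp
      then show False
        using a_low[of j] that by (simp add: J_def)
    qed
    \<comment> \<open>The edge of least slope ends at \<open>(k, 0)\<close>, because \<open>a k\<close> does not vanish at \<open>0\<close>.\<close>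
    obtain j0 where j0: "j0 \<in> J"
      and min: "\<And>j. j \<in> J \<Longrightarrow> real (d j0) / real (k - j0) \<le> real (d j) / real (k - j)"
    proof -
      obtain j0 where "is_arg_min (\<lambda>j. real (d j) / real (k - j)) (\<lambda>j. j \<in> J) j0"
        using ex_is_arg_min_if_finite[OF J(1)] J(2) by blast
      then show thesis
        using that[of j0] unfolding is_arg_min_linorder by blast
    qed
    define q where "q = k - j0"
    define e where "e = d j0"
    have "j0 < k"
      using j0 by (simp add: J_def)
    then have "q > 0"
      by (simp add: q_def)
    have "e > 0"
      using d_pos[OF j0] by (simp add: e_def)
    have slope: "e * (k - j) \<le> q * d j" if "j \<in> J" for j
    proof -
      have "j < k"
        using that by (simp add: J_def)
      then have "real (d j0) * real (k - j) \<le> real (d j) * real (k - j0)"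
        using min[OF that] \<open>j0 < k\<close> by (simp add: field_simps)
      then have "d j0 * (k - j) \<le> d j * (k - j0)"
        by (simp only: of_nat_mult[symmetric] of_nat_le_iff)
      then show ?thesis
        by (simp add: e_def q_def mult.commute)
    qed
    \<comment> \<open>The coefficients of \<open>s\<^bsup>- e k\<^esup> G (s\<^sup>q) (s\<^sup>e y)\<close>; \<open>slope\<close> makes every exponent nonnegative.\<close>
    define h where "h = (\<lambda>j s. if j < k
        then if j \<in> J then s ^ (q * d j - e * (k - j)) * b j (s ^ q) else 0
        else s ^ (e * (j - k)) * a j (s ^ q))"
    define P where "P = (\<lambda>s. \<Sum>j\<le>n. monom (h j s) j)"
    have h_an: "h j analytic_on {0}" for j
      unfolding h_def
      by (cases "j < k"; cases "j \<in> J")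
        (auto intro!: analytic_on_mult analytic_on_power analytic_on_const analytic_on_ident
          analytic_on_compose_power db(1) a_an \<open>q > 0\<close>)
    have P_coeff: "coeff (P s) j = (if j \<le> n then h j s else 0)" for s j
      by (simp add: P_def coeff_sum)
    have P_deg: "degree (P s) \<le> n" for s
      by (rule degree_le) (simp add: P_coeff)
    have P_fam: "analytic_family n P"
    proof -
      have "(\<lambda>s. coeff (P s) j) analytic_on {0}" for j
        using h_an[of j] by (cases "j \<le> n") (simp_all add: P_coeff)
      then show ?thesis
        using P_deg by (simp add: analytic_family_def)
    qed
    have "\<forall>\<^sub>F t in nhds 0. \<forall>j\<in>{..<k} - J. a j t = 0"
      by (subst eventually_ball_finite_distrib) (auto simp: J_def)
    from eventually_compose_filterlim[OF this filterlim_power_nhds_0[OF \<open>q > 0\<close>]]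
    have rescale: "\<forall>\<^sub>F s in nhds 0. \<forall>y. poly (G (s ^ q)) (s ^ e * y) = s ^ (e * k) * poly (P s) y"
    proof eventually_elim
      case (elim s)
      have "a j (s ^ q) * (s ^ e) ^ j = s ^ (e * k) * h j s" for j
      proof (cases "j < k")
        case True
        show ?thesis
        proof (cases "j \<in> J")
          case J: True
          have "q * d j + e * j = e * k + (q * d j - e * (k - j))"
          proof -
            have "e * k = e * (k - j) + e * j"
              using True by (simp flip: distrib_left)
            then show ?thesis
              using slope[OF J] by simp
          qed
          then have "s ^ (q * d j) * s ^ (e * j) = s ^ (e * k) * s ^ (q * d j - e * (k - j))"
            by (simp only: power_add[symmetric])
          then show ?thesis
            using True J by (simp add: h_def db(3)[OF J] power_mult[symmetric] mult_ac)
        next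
          case False
          then show ?thesis
            using True elim by (simp add: h_def)
        qed
      next
        case False
        then have "e * j = e * k + e * (j - k)"
          by (simp flip: distrib_left)
        then show ?thesis
          using False by (simp add: h_def power_mult[symmetric] power_add mult_ac)
      qed
      then have "a j (s ^ q) * (s ^ e * y) ^ j = s ^ (e * k) * (h j s * y ^ j)" for j y
        by (simp add: power_mult_distrib mult.assoc[symmetric])
      then show ?case
        unfolding poly_sum_upto[OF analytic_family_degree[OF G_fam]] poly_sum_upto[OF P_deg]
          sum_distrib_left
        by (auto simp: a_def P_coeff intro!: sum.cong)
    qed
    have P0: "coeff (P 0) j = (if j < k then if j \<in> J \<and> q * d j = e * (k - j) then b j 0 else 0
        else if j = k then a k 0 else 0)" for j
      using slope[of j] \<open>k \<le> n\<close> \<open>e > 0\<close> \<open>q > 0\<close>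
      by (auto simp: P_coeff h_def power_0_left)
    have P0_deg: "degree (P 0) = k"
      using a_k by (intro order_antisym degree_le le_degree allI impI) (simp_all add: P0)
    have "P 0 \<noteq> 0"
      using P0_deg \<open>k > 0\<close> by auto
    have "\<not> constant (poly (P 0))"
      using P0_deg \<open>k > 0\<close> by (simp only: constant_degree)
    from Fundamental_Theorem_Algebra.fundamental_theorem_of_algebra[OF this]
    obtain z where z: "poly (P 0) z = 0" ..
    have "order z (P 0) < Suc (k - 1)"
    proof (rule order_less_if_no_subleading)
      show "degree (P 0) = Suc (k - 1)"
        using P0_deg \<open>k > 0\<close> by simp
      show "coeff (P 0) (k - 1) = 0"
        using J(3) \<open>k > 0\<close> by (simp add: P0)
      show "j0 \<le> k - 1"
        using \<open>j0 < k\<close> by simp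
      show "coeff (P 0) j0 \<noteq> 0"
        using j0 \<open>j0 < k\<close> db(2)[OF j0] by (simp add: P0 q_def e_def)
    qed
    then have "order z (P 0) < order c (p 0)"
      using \<open>k > 0\<close> by (simp add: k_def)
    from less.hyps[OF this P_fam \<open>P 0 \<noteq> 0\<close> z]
    obtain N g where Ng: "N > 0" "g analytic_on {0}" "\<forall>\<^sub>F u in nhds 0. poly (P (u ^ N)) (g u) = 0"
      by blast
    define g' where "g' = (\<lambda>u. \<mu> (u ^ (N * q)) + (u ^ N) ^ e * g u)"
    have g': "g' analytic_on {0}"
      unfolding g'_def
      by (intro analytic_on_add analytic_on_mult analytic_on_power analytic_on_ident
          analytic_on_compose_power \<mu>(1) Ng(2)) (use Ng(1) \<open>q > 0\<close> in simp)
    have g'0: "g' 0 = c"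
      using \<mu>(2) Ng(1) \<open>e > 0\<close> \<open>q > 0\<close> by (simp add: g'_def zero_power)
    have g'_root: "\<forall>\<^sub>F u in nhds 0. poly (p (u ^ (N * q))) (g' u) = 0"
      using Ng(3) eventually_compose_filterlim[OF rescale filterlim_power_nhds_0[OF Ng(1)]]
    proof eventually_elim
      case (elim u)
      then show ?case
        using poly_G[of "u ^ (N * q)" "(u ^ N) ^ e * g u"]
        by (simp add: g'_def power_mult)
    qed
    have "N * q > 0"
      using Ng(1) \<open>q > 0\<close> by simp
    show ?thesis
      by (rule exI[of _ "N * q"], rule exI[of _ g'], intro conjI) fact+
  qed
qed

section \<open>Real-rooted families split analytically\<close>

lemma has_fps_expansion_eventually_sums:
  fixes F :: "'a :: {banach, real_normed_field} fps"
  assumes "f has_fps_expansion F"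
  shows "\<forall>\<^sub>F z in nhds 0. (\<lambda>k. fps_nth F k * z ^ k) sums f z"
proof -
  have "\<forall>\<^sub>F z in nhds 0. z \<in> eball 0 (fps_conv_radius F)"
    using assms by (intro eventually_nhds_in_open) (auto simp: has_fps_expansion_def zero_ereal_def)
  moreover have "\<forall>\<^sub>F z in nhds 0. eval_fps F z = f z"
    using assms by (simp add: has_fps_expansion_def)
  ultimately show ?thesis
  proof eventually_elim
    case (elim z)
    then show ?case
      using sums_eval_fps[of z F] by simp
  qed
qed

lemma eventually_nhds_of_real:
  assumes "\<forall>\<^sub>F z in nhds (of_real x :: complex). P z"
  shows "\<forall>\<^sub>F t in nhds (x :: real). P (of_real t)"
proof -
  have "filterlim (\<lambda>r :: real. complex_of_real r) (nhds (of_real x)) (nhds x)"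
    by (intro tendsto_of_real filterlim_ident)
  then show ?thesis
    by (rule eventually_compose_filterlim[OF assms])
qed

lemmas eventually_nhds_0_of_real = eventually_nhds_of_real[of _ 0, unfolded of_real_0]

lemma
  assumes "f has_fps_expansion F"
  shows has_fps_expansion_Re: "(\<lambda>r. Re (f (of_real r))) has_fps_expansion Abs_fps (\<lambda>k. Re (fps_nth F k))"
    and has_fps_expansion_Im: "(\<lambda>r. Im (f (of_real r))) has_fps_expansion Abs_fps (\<lambda>k. Im (fps_nth F k))"
proof -
  note ev = eventually_nhds_0_of_real[OF has_fps_expansion_eventually_sums[OF assms]]
  show "(\<lambda>r. Re (f (of_real r))) has_fps_expansion Abs_fps (\<lambda>k. Re (fps_nth F k))"
    by (rule has_fps_expansionI, use ev in eventually_elim)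
      (drule sums_Re, simp flip: of_real_power)
  show "(\<lambda>r. Im (f (of_real r))) has_fps_expansion Abs_fps (\<lambda>k. Im (fps_nth F k))"
    by (rule has_fps_expansionI, use ev in eventually_elim)
      (drule sums_Im, simp flip: of_real_power)
qed

lemma fps_expansion_zero_real:
  fixes F :: "real fps"
  assumes "f has_fps_expansion F" and "\<forall>\<^sub>F x in at 0. f x = 0"
  shows "F = 0"
proof (rule ccontr)
  assume "F \<noteq> 0"
  define n where "n = subdegree F"
  define g where "g = (\<lambda>x. if x = 0 then fps_nth F n else f x / x ^ n)"
  have "g has_fps_expansion fps_shift n F"
    unfolding g_def by (rule has_fps_expansion_shift[OF assms(1)]) (simp_all add: n_def)
  then have "isCont g 0"
    by (rule has_fps_expansion_imp_continuous)
  then have "(g \<longlongrightarrow> g 0) (at 0)"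
    by (rule isContD)
  moreover have "\<forall>\<^sub>F x in at 0. g x = 0"
    using assms(2) eventually_neq_at_within[of 0] by eventually_elim (simp add: g_def)
  ultimately have "((\<lambda>x :: real. 0 :: real) \<longlongrightarrow> g 0) (at 0)"
    by (rule Lim_transform_eventually)
  then have "g 0 = 0"
    by (simp add: tendsto_const_iff)
  then show False
    using \<open>F \<noteq> 0\<close> by (simp add: g_def n_def)
qed

lemma real_on_reals_imp_real_coeffs:
  assumes "f has_fps_expansion F" and "\<forall>\<^sub>F r in nhds (0 :: real). f (of_real r) \<in> \<real>"
  shows "Im (fps_nth F k) = 0"
proof -
  have "\<forall>\<^sub>F r in nhds 0. Im (f (of_real r)) = 0"
    using assms(2) by eventually_elim (simp add: complex_is_Real_iff)
  then have "\<forall>\<^sub>F r in at 0. Im (f (of_real r)) = 0"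
    by (rule filter_leD[OF at_within_le_nhds])
  from fps_expansion_zero_real[OF has_fps_expansion_Im[OF assms(1)] this]
  show ?thesis
    by (simp add: fps_eq_iff)
qed

text \<open>The condition \<open>s\<^sup>N \<in> \<real>\<close> holds on the rays spanned by \<open>1\<close> and by \<open>\<zeta> = cis (\<pi> / N)\<close>, where
  \<open>\<zeta>\<^sup>N = -1\<close>. Being real on the first ray makes every coefficient \<open>F\<^sub>k\<close> real, being real on the
  second makes every \<open>F\<^sub>k \<zeta>\<^sup>k\<close> real. As \<open>\<zeta>\<^sup>k\<close> is real only for \<open>N dvd k\<close>, the other coefficients
  vanish.\<close>

lemma fps_coeff_zero_if_real_on_rays:
  fixes f :: "complex \<Rightarrow> complex"
  assumes F: "f has_fps_expansion F" and "N > 0"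
    and real: "\<forall>\<^sub>F s in nhds 0. s ^ N \<in> \<real> \<longrightarrow> f s \<in> \<real>" and "\<not> N dvd k"
  shows "fps_nth F k = 0"
proof -
  define \<zeta> where "\<zeta> = cis (pi / real N)"
  have \<zeta>N: "\<zeta> ^ N = -1"
    using \<open>N > 0\<close> by (simp add: \<zeta>_def Complex.DeMoivre)
  have 1: "\<forall>\<^sub>F r in nhds (0 :: real). f (of_real r) \<in> \<real>"
    using eventually_nhds_0_of_real[OF real] by eventually_elim (simp flip: of_real_power)
  have lim: "filterlim (\<lambda>s. \<zeta> * s) (nhds 0) (nhds 0)"
  proof -
    have "((\<lambda>s. \<zeta> * s) \<longlongrightarrow> \<zeta> * 0) (nhds 0)"
      by (intro tendsto_intros filterlim_ident)
    then show ?thesis by simp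
  qed
  have G: "(\<lambda>s. f (\<zeta> * s)) has_fps_expansion Abs_fps (\<lambda>k. fps_nth F k * \<zeta> ^ k)"
    by (rule has_fps_expansionI)
      (use eventually_compose_filterlim[OF has_fps_expansion_eventually_sums[OF F] lim]
        in \<open>simp add: power_mult_distrib mult.assoc\<close>)
  have 2: "\<forall>\<^sub>F r in nhds (0 :: real). f (\<zeta> * of_real r) \<in> \<real>"
    using eventually_nhds_0_of_real[OF eventually_compose_filterlim[OF real lim]]
    by eventually_elim (simp add: power_mult_distrib \<zeta>N flip: of_real_power)
  have "Im (fps_nth F k) = 0" and "Im (fps_nth F k * \<zeta> ^ k) = 0"
    using real_on_reals_imp_real_coeffs[OF F 1, of k] real_on_reals_imp_real_coeffs[OF G 2, of k]
    by simp_all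
  moreover have "\<zeta> ^ k = cis (real k * (pi / real N))"
    by (simp add: \<zeta>_def Complex.DeMoivre)
  ultimately have "Re (fps_nth F k) * sin (real k * (pi / real N)) = 0"
    by simp
  moreover have "sin (real k * (pi / real N)) \<noteq> 0"
  proof
    assume "sin (real k * (pi / real N)) = 0"
    then obtain i :: int where "real k * (pi / real N) = of_int i * pi"
      by (auto simp: sin_zero_iff_int2)
    then have "real k = of_int i * real N"
      using \<open>N > 0\<close> by (simp add: field_simps)
    then have "int k = i * int N"
      by (metis of_int_eq_iff of_int_mult of_int_of_nat_eq)
    then have "int N dvd int k"
      by simp
    then show False
      using \<open>\<not> N dvd k\<close> by simp
  qed
  ultimately show ?thesis
    using \<open>Im (fps_nth F k) = 0\<close> by (simp add: complex_eq_iff)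
qed

lemma unramified_if_real_on_rays:
  assumes g: "g analytic_on {0}" and "N > 0"
    and real: "\<forall>\<^sub>F s in nhds 0. s ^ N \<in> \<real> \<longrightarrow> g s \<in> \<real>"
  shows "\<exists>h. h analytic_on {0} \<and> (\<forall>\<^sub>F s in nhds 0. g s = h (s ^ N))"
proof -
  obtain F where F: "g has_fps_expansion F"
    using analytic_at_imp_has_fps_expansion_0[OF g] by blast
  define H where "H = Abs_fps (\<lambda>k. fps_nth F (N * k))"
  have mono: "strict_mono (\<lambda>k. N * k)"
    using \<open>N > 0\<close> by (simp add: strict_mono_def)
  have zero: "fps_nth F k * s ^ k = 0" if "k \<notin> range (\<lambda>k. N * k)" for k s
    using fps_coeff_zero_if_real_on_rays[OF F \<open>N > 0\<close> real, of k] that by (auto simp: dvd_def)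
  have ev: "\<forall>\<^sub>F s in nhds 0. (\<lambda>k. fps_nth H k * (s ^ N) ^ k) sums g s"
    using has_fps_expansion_eventually_sums[OF F]
  proof eventually_elim
    case (elim s)
    then show ?case
      using sums_mono_reindex[OF mono, where f = "\<lambda>k. fps_nth F k * s ^ k" and c = "g s"] zero
      by (simp add: H_def power_mult)
  qed
  then obtain r where r: "r > 0" "\<And>s. norm s < r \<Longrightarrow> (\<lambda>k. fps_nth H k * (s ^ N) ^ k) sums g s"
    by (auto simp: eventually_nhds_metric)
  define h where "h = eval_fps H"
  have h: "h (s ^ N) = g s" if "norm s < r" for s
    using r(2)[OF that] by (simp add: h_def eval_fps_def sums_iff)
  have "fps_conv_radius H > 0"
  proof -
    have "summable (\<lambda>k. fps_nth H k * (of_real (r / 2) ^ N) ^ k)"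
      using r(2)[of "of_real (r / 2)"] \<open>r > 0\<close> by (simp add: sums_iff)
    then have "fps_conv_radius H \<ge> ereal (norm ((of_real (r / 2) :: complex) ^ N))"
      unfolding fps_conv_radius_def by (rule conv_radius_geI)
    moreover have "norm ((of_real (r / 2) :: complex) ^ N) > 0"
      using \<open>r > 0\<close> by simp
    ultimately show ?thesis
      by (metis ereal_less(2) less_le_trans)
  qed
  then have "h has_fps_expansion H"
    by (simp add: has_fps_expansion_def h_def)
  then have "h analytic_on {0}"
    by (rule has_fps_expansion_imp_analytic_0)
  moreover have "\<forall>\<^sub>F s in nhds 0. g s = h (s ^ N)"
    using h \<open>r > 0\<close> by (auto simp: eventually_nhds_metric)
  ultimately show ?thesis
    by blast
qed

definition real_rooted_near_0 :: "(complex \<Rightarrow> complex poly) \<Rightarrow> bool" where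
  "real_rooted_near_0 p \<longleftrightarrow> (\<forall>\<^sub>F t in nhds 0. t \<in> \<real> \<longrightarrow> (\<forall>x. poly (p t) x = 0 \<longrightarrow> x \<in> \<real>))"

text \<open>Roots at real parameters are real, on both sides of \<open>0\<close>, so the Puiseux root
  \<open>g\<close> with \<open>p (s\<^sup>N) (g s) = 0\<close> satisfies the hypothesis of \<open>unramified_if_real_on_rays\<close> and is in
  fact an analytic function of \<open>s\<^sup>N\<close>.\<close>

lemma analytic_root:
  assumes fam: "analytic_family n p" and rr: "real_rooted_near_0 p" and deg: "degree (p 0) > 0"
  shows "\<exists>h. h analytic_on {0} \<and> (\<forall>\<^sub>F t in nhds 0. poly (p t) (h t) = 0)"
proof -
  have "\<not> constant (poly (p 0))"
    using deg by (simp only: constant_degree)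
  from Fundamental_Theorem_Algebra.fundamental_theorem_of_algebra[OF this]
  obtain c where "poly (p 0) c = 0" ..
  moreover have "p 0 \<noteq> 0"
    using deg by auto
  ultimately obtain N g where N: "N > 0" and g: "g analytic_on {0}"
    and root: "\<forall>\<^sub>F s in nhds 0. poly (p (s ^ N)) (g s) = 0"
    using puiseux_root[OF fam] by blast
  have "\<forall>\<^sub>F s in nhds 0. s ^ N \<in> \<real> \<longrightarrow> g s \<in> \<real>"
    using root eventually_compose_filterlim[OF rr[unfolded real_rooted_near_0_def] filterlim_power_nhds_0[OF N]]
    by eventually_elim blast
  from unramified_if_real_on_rays[OF g N this] obtain h where h: "h analytic_on {0}"
    and gh: "\<forall>\<^sub>F s in nhds 0. g s = h (s ^ N)" by blast
  have "\<forall>\<^sub>F s in nhds 0. poly (p (s ^ N)) (h (s ^ N)) = 0"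
    using root gh by eventually_elim simp
  then obtain r where r: "r > 0" "\<And>s. norm s < r \<Longrightarrow> poly (p (s ^ N)) (h (s ^ N)) = 0"
    by (auto simp: eventually_nhds_metric)
  \<comment> \<open>Every small \<open>t\<close> is an \<open>N\<close>-th power of a small \<open>s\<close>.\<close>
  have "poly (p t) (h t) = 0" if "norm t < r ^ N" for t
  proof -
    obtain s where s: "t = s ^ N"
    proof (cases "t = 0")
      case True
      then show thesis
        using that[of 0] N by (simp add: zero_power)
    next
      case False
      have "exp (Ln t / of_nat N) ^ N = t"
        using False N by (simp flip: exp_of_nat_mult)
      then show thesis
        using that by metis
    qed
    have "norm s ^ N < r ^ N"
      using \<open>norm t < r ^ N\<close> by (simp add: s norm_power)
    then have "norm s < r"
      using \<open>r > 0\<close> by (meson less_imp_le power_less_imp_less_base)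
    then show ?thesis
      using r(2)[of s] by (simp add: s)
  qed
  moreover have "r ^ N > 0"
    using \<open>r > 0\<close> by simp
  ultimately have "\<forall>\<^sub>F t in nhds 0. poly (p t) (h t) = 0"
    by (auto simp: eventually_nhds_metric)
  then show ?thesis
    using h by blast
qed

lemma coeff_synthetic_div_Suc:
  fixes f :: "complex poly"
  shows "coeff (synthetic_div f c) j = coeff f (Suc j) + c * coeff (synthetic_div f c) (Suc j)"
proof -
  have "coeff f (Suc j) = coeff ([:-c, 1:] * synthetic_div f c + [:poly f c:]) (Suc j)"
    by (simp only: synthetic_div_correct')
  then show ?thesis
    by simp
qed

lemma analytic_family_synthetic_div:
  assumes fam: "analytic_family (Suc n) p" and h: "h analytic_on {0}"
  shows "analytic_family n (\<lambda>t. synthetic_div (p t) (h t))"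
proof -
  have deg: "degree (synthetic_div (p t) (h t)) \<le> n" for t
    using analytic_family_degree[OF fam, of t] by (simp add: degree_synthetic_div)
  have low: "(\<lambda>t. coeff (synthetic_div (p t) (h t)) j) analytic_on {0}" if "j \<le> Suc n" for j
    using that
  proof (induction rule: inc_induct)
    case base
    have "coeff (synthetic_div (p t) (h t)) (Suc n) = 0" for t
      using deg[of t] by (intro coeff_eq_0) simp
    then show ?case by simp
  next
    case (step j)
    then show ?case
      by (subst coeff_synthetic_div_Suc)
        (intro analytic_on_add analytic_on_mult analytic_family_coeff[OF fam] h)
  qed
  have "(\<lambda>t. coeff (synthetic_div (p t) (h t)) j) analytic_on {0}" for j
  proof (cases "j \<le> Suc n")
    case False
    have "coeff (synthetic_div (p t) (h t)) j = 0" for t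
      using False deg[of t] by (intro coeff_eq_0) simp
    then show ?thesis by simp
  qed (rule low)
  then show ?thesis
    using deg by (simp add: analytic_family_def)
qed

text \<open>Dividing by the linear factor of one analytic root leaves an analytic family of lower degree
  whose roots are among those of \<open>p\<close>, so it is again real-rooted.\<close>

lemma analytic_splitting:
  assumes "analytic_family n p" and "\<And>t. coeff (p t) n = 1" and "real_rooted_near_0 p"
  shows "\<exists>m. (\<forall>i<n. m i analytic_on {0}) \<and> (\<forall>\<^sub>F t in nhds 0. p t = (\<Prod>i<n. [:- m i t, 1:]))"
  using assms
proof (induction n arbitrary: p)
  case 0
  have "p t = 1" for t
  proof -
    obtain a where "p t = [:a:]"
      using analytic_family_degree[OF 0(1), of t] degree_eq_zeroE by auto
    then show ?thesis
      using 0(2)[of t] by (simp add: one_pCons)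
  qed
  then show ?case
    by simp
next
  case (Suc n)
  note fam = Suc.prems(1)
  have "degree (p 0) > 0"
    using le_degree[of "p 0" "Suc n"] Suc.prems(2)[of 0] by simp
  from analytic_root[OF fam Suc.prems(3) this] obtain h where h: "h analytic_on {0}"
    and root: "\<forall>\<^sub>F t in nhds 0. poly (p t) (h t) = 0" by blast
  define q where "q = (\<lambda>t. synthetic_div (p t) (h t))"
  have q_fam: "analytic_family n q"
    unfolding q_def by (rule analytic_family_synthetic_div[OF fam h])
  have fact: "\<forall>\<^sub>F t in nhds 0. p t = q t * [:- h t, 1:]"
    using root
  proof eventually_elim
    case (elim t)
    then show ?case
      using synthetic_div_correct'[of "h t" "p t"] by (simp add: q_def mult.commute)
  qed
  have lead: "coeff (q t) n = 1" for t
  proof -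
    have "coeff (q t) (Suc n) = 0"
      using analytic_family_degree[OF q_fam, of t] by (intro coeff_eq_0) simp
    then show ?thesis
      using coeff_synthetic_div_Suc[of "p t" "h t" n] Suc.prems(2)[of t] by (simp add: q_def)
  qed
  have "real_rooted_near_0 q"
    unfolding real_rooted_near_0_def
    using Suc.prems(3)[unfolded real_rooted_near_0_def] fact
    by eventually_elim simp
  from Suc.IH[OF q_fam lead this] obtain m where m: "\<forall>i<n. m i analytic_on {0}"
    and split: "\<forall>\<^sub>F t in nhds 0. q t = (\<Prod>i<n. [:- m i t, 1:])" by blast
  define m' where "m' = m(n := h)"
  have "\<forall>i<Suc n. m' i analytic_on {0}"
    using m h by (simp add: m'_def less_Suc_eq)
  moreover have "\<forall>\<^sub>F t in nhds 0. p t = (\<Prod>i<Suc n. [:- m' i t, 1:])"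
    using fact split by eventually_elim (simp add: m'_def)
  ultimately show ?case
    by blast
qed

section \<open>Real analytic functions on the line\<close>

text \<open>Analyticity at a point is expressed through a holomorphic extension: then it holds
  automatically at all nearby points, and the closure properties and isolated zeros come
  from complex analysis. A real power series is recovered by taking real parts of the
  coefficients.\<close>

definition real_analytic_at :: "(real \<Rightarrow> real) \<Rightarrow> real \<Rightarrow> bool" where
  "real_analytic_at f x \<longleftrightarrow>
     (\<exists>g. g analytic_on {of_real x} \<and> (\<forall>\<^sub>F t in nhds x. of_real (f t) = (g (of_real t) :: complex)))"

lemma real_analytic_at_cong:
  assumes "\<forall>\<^sub>F t in nhds x. f t = f' t" and "real_analytic_at f' x"
  shows "real_analytic_at f x"
proof -
  obtain g where g: "g analytic_on {of_real x}" "\<forall>\<^sub>F t in nhds x. of_real (f' t) = (g (of_real t) :: complex)"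
    using assms(2) unfolding real_analytic_at_def by blast
  have "\<forall>\<^sub>F t in nhds x. of_real (f t) = (g (of_real t) :: complex)"
    using g(2) assms(1) by eventually_elim simp
  then show ?thesis
    using g(1) unfolding real_analytic_at_def by blast
qed

lemma real_analytic_at_const: "real_analytic_at (\<lambda>_. c) x"
  unfolding real_analytic_at_def by (rule exI[of _ "\<lambda>_. of_real c"]) simp

lemma real_analytic_at_diff:
  assumes "real_analytic_at f x" and "real_analytic_at f' x"
  shows "real_analytic_at (\<lambda>t. f t - f' t) x"
proof -
  obtain g where g: "g analytic_on {of_real x}" "\<forall>\<^sub>F t in nhds x. of_real (f t) = (g (of_real t) :: complex)"
    using assms(1) unfolding real_analytic_at_def by blast
  obtain g' where g': "g' analytic_on {of_real x}" "\<forall>\<^sub>F t in nhds x. of_real (f' t) = (g' (of_real t) :: complex)"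
    using assms(2) unfolding real_analytic_at_def by blast
  have "\<forall>\<^sub>F t in nhds x. of_real (f t - f' t) = (g (of_real t) - g' (of_real t) :: complex)"
    using g(2) g'(2) by eventually_elim simp
  then show ?thesis
    using analytic_on_diff[OF g(1) g'(1)] unfolding real_analytic_at_def by blast
qed

lemma real_analytic_at_mult:
  assumes "real_analytic_at f x" and "real_analytic_at f' x"
  shows "real_analytic_at (\<lambda>t. f t * f' t) x"
proof -
  obtain g where g: "g analytic_on {of_real x}" "\<forall>\<^sub>F t in nhds x. of_real (f t) = (g (of_real t) :: complex)"
    using assms(1) unfolding real_analytic_at_def by blast
  obtain g' where g': "g' analytic_on {of_real x}" "\<forall>\<^sub>F t in nhds x. of_real (f' t) = (g' (of_real t) :: complex)"
    using assms(2) unfolding real_analytic_at_def by blast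
  have "\<forall>\<^sub>F t in nhds x. of_real (f t * f' t) = (g (of_real t) * g' (of_real t) :: complex)"
    using g(2) g'(2) by eventually_elim simp
  then show ?thesis
    using analytic_on_mult[OF g(1) g'(1)] unfolding real_analytic_at_def by blast
qed

lemma real_analytic_at_prod:
  assumes "\<And>i. i \<in> I \<Longrightarrow> real_analytic_at (f i) x"
  shows "real_analytic_at (\<lambda>t. \<Prod>i\<in>I. f i t) x"
  using assms
  by (induction I rule: infinite_finite_induct)
    (simp_all add: real_analytic_at_const real_analytic_at_mult)

lemma real_analytic_at_nearby:
  assumes "real_analytic_at f x"
  shows "\<forall>\<^sub>F y in nhds x. real_analytic_at f y"
proof -
  obtain g where g: "g analytic_on {of_real x}" "\<forall>\<^sub>F t in nhds x. of_real (f t) = (g (of_real t) :: complex)"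
    using assms unfolding real_analytic_at_def by blast
  obtain e where e: "e > 0" "g holomorphic_on ball (of_real x) e"
    using g(1) by (auto simp: analytic_at_ball)
  have "\<forall>\<^sub>F z in nhds (complex_of_real x). z \<in> ball (of_real x) e"
    using e(1) by (intro eventually_nhds_in_open) auto
  then have "\<forall>\<^sub>F z in nhds (complex_of_real x). g analytic_on {z}"
    unfolding analytic_at
    by eventually_elim (rule exI[of _ "ball (of_real x) e"], simp add: e(2))
  from eventually_nhds_of_real[OF this]
  have "\<forall>\<^sub>F y in nhds x. g analytic_on {of_real y}" .
  moreover have "\<forall>\<^sub>F y in nhds x. \<forall>\<^sub>F t in nhds y. of_real (f t) = (g (of_real t) :: complex)"
    using g(2) by (simp only: eventually_eventually)
  ultimately show ?thesis
    unfolding real_analytic_at_def by eventually_elim blast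
qed

lemma real_analytic_at_imp_has_fps_expansion:
  assumes "real_analytic_at f x"
  shows "\<exists>F. (\<lambda>h. f (x + h)) has_fps_expansion F"
proof -
  obtain g where g: "g analytic_on {of_real x}" "\<forall>\<^sub>F t in nhds x. of_real (f t) = (g (of_real t) :: complex)"
    using assms unfolding real_analytic_at_def by blast
  obtain F where F: "(\<lambda>z. g (of_real x + z)) has_fps_expansion F"
    using analytic_at_imp_has_fps_expansion[OF g(1)] by blast
  have "filterlim (\<lambda>h. x + h) (nhds (x + 0)) (nhds (0 :: real))"
    by (intro tendsto_add tendsto_const filterlim_ident)
  then have "filterlim (\<lambda>h. x + h) (nhds x) (nhds 0)"
    by simp
  then have "\<forall>\<^sub>F h in nhds 0. of_real (f (x + h)) = g (of_real (x + h))"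
    by (rule eventually_compose_filterlim[OF g(2)])
  then have "\<forall>\<^sub>F h in nhds 0. f (x + h) = Re (g (of_real x + of_real h))"
    by eventually_elim (metis Re_complex_of_real of_real_add)
  from has_fps_expansion_cong[OF this refl]
  have "(\<lambda>h. f (x + h)) has_fps_expansion Abs_fps (\<lambda>k. Re (fps_nth F k))"
    using has_fps_expansion_Re[OF F] by blast
  then show ?thesis
    by blast
qed

lemma real_analytic_at_zero_cases:
  assumes "real_analytic_at f x"
  shows "(\<forall>\<^sub>F t in nhds x. f t = 0) \<or> (\<forall>\<^sub>F t in at x. f t \<noteq> 0)"
proof -
  obtain g where g: "g analytic_on {of_real x}" "\<forall>\<^sub>F t in nhds x. of_real (f t) = (g (of_real t) :: complex)"
    using assms unfolding real_analytic_at_def by blast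
  define a where "a = (\<lambda>z. g (of_real x + z))"
  have "(g \<circ> (\<lambda>z. of_real x + z)) analytic_on {0}"
    by (rule analytic_on_compose) (use g(1) in \<open>auto intro!: analytic_intros\<close>)
  then have a: "a analytic_on {0}"
    by (simp add: a_def o_def)
  have fa: "\<forall>\<^sub>F t in nhds x. of_real (f t) = a (of_real (t - x))"
    using g(2) by eventually_elim (simp add: a_def)
  have lim: "filterlim (\<lambda>t. complex_of_real (t - x)) (nhds 0) (nhds x)"
  proof -
    have "((\<lambda>t. complex_of_real (t - x)) \<longlongrightarrow> of_real (x - x)) (nhds x)"
      by (intro tendsto_intros filterlim_ident)
    then show ?thesis by simp
  qed
  show ?thesis
  proof (cases "\<forall>\<^sub>F z in nhds 0. a z = 0")
    case True
    have "\<forall>\<^sub>F t in nhds x. f t = 0"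
      using fa eventually_compose_filterlim[OF True lim] by eventually_elim simp
    then show ?thesis ..
  next
    case False
    then obtain d b where b: "b analytic_on {0}" "b 0 \<noteq> 0" "\<And>z. a z = z ^ d * b z"
      using analytic_order_factorization[OF a] by blast
    have "(b \<longlongrightarrow> b 0) (nhds 0)"
      using analytic_at_imp_isCont[OF b(1)] by (simp add: isCont_def tendsto_nhds_iff)
    then have "\<forall>\<^sub>F z in nhds 0. b z \<noteq> 0"
      using b(2) by (rule tendsto_imp_eventually_ne)
    from eventually_compose_filterlim[OF this lim] fa
    have "\<forall>\<^sub>F t in nhds x. t \<noteq> x \<longrightarrow> f t \<noteq> 0"
      by eventually_elim (auto simp: b(3) simp flip: of_real_diff)
    then show ?thesis
      by (simp add: eventually_at_filter)
  qed
qed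

text \<open>By the alternative \<open>real_analytic_at_zero_cases\<close>, near any point \<open>x\<close> either \<open>f\<close> vanishes around
  every nearby point or around none of them. Bolzano's interval induction chains these local
  equivalences together.\<close>

lemma real_analytic_zero_propagates:
  assumes "a \<le> b" and an: "\<And>x. a \<le> x \<Longrightarrow> x \<le> b \<Longrightarrow> real_analytic_at f x"
  shows "(\<forall>\<^sub>F t in nhds a. f t = 0) \<longleftrightarrow> (\<forall>\<^sub>F t in nhds b. f t = 0)"
  using assms(1)
proof (induction a b rule: Bolzano)
  case (trans a b c)
  then show ?case by simp
next
  case (local x)
  define Z where "Z = (\<lambda>y. \<forall>\<^sub>F t in nhds y. f t = 0)"
  have "\<forall>\<^sub>F y in nhds x. Z y \<longleftrightarrow> Z x"
    using real_analytic_at_zero_cases[OF an[OF local]]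
  proof
    assume "\<forall>\<^sub>F t in nhds x. f t = 0"
    then have "Z x" "\<forall>\<^sub>F y in nhds x. Z y"
      by (simp_all add: Z_def eventually_eventually)
    then show ?thesis
      by (elim eventually_mono) simp
  next
    assume nz: "\<forall>\<^sub>F t in at x. f t \<noteq> 0"
    have "\<not> Z x"
    proof
      assume "Z x"
      then have "\<forall>\<^sub>F t in at x. f t = 0"
        unfolding Z_def by (rule filter_leD[OF at_within_le_nhds])
      with nz have "\<forall>\<^sub>F t in at x. False"
        by eventually_elim simp
      then show False
        by simp
    qed
    have "\<forall>\<^sub>F y in nhds x. y \<noteq> x \<longrightarrow> f y \<noteq> 0"
      using nz by (simp add: eventually_at_filter)
    then show ?thesis
    proof eventually_elim
      case (elim y)
      show ?case
      proof (cases "y = x")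
        case False
        then have "\<not> Z y"
          using elim eventually_nhds_x_imp_x[of "\<lambda>t. f t = 0" y] by (auto simp: Z_def)
        then show ?thesis
          using \<open>\<not> Z x\<close> by simp
      qed simp
    qed
  qed
  then obtain d where "d > 0" and d: "\<And>y. dist y x < d \<Longrightarrow> Z y \<longleftrightarrow> Z x"
    by (auto simp: eventually_nhds_metric)
  have "Z u \<longleftrightarrow> Z v" if "u \<le> x" "x \<le> v" "v - u < d" for u v
    using d[of u] d[of v] that by (simp add: dist_real_def)
  then show ?case
    using \<open>d > 0\<close> by (auto simp: Z_def)
qed

lemma real_analytic_identity:
  assumes an: "\<And>x. real_analytic_at f x" and zero: "\<forall>\<^sub>F t in nhds x. f t = 0"
  shows "f y = 0"
proof -
  have "\<forall>\<^sub>F t in nhds y. f t = 0"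
    using real_analytic_zero_propagates[of x y f] real_analytic_zero_propagates[of y x f] an zero
    by (cases "x \<le> y") auto
  then show ?thesis
    by (rule eventually_nhds_x_imp_x)
qed

section \<open>Continuation of analytic roots along the line\<close>

lemma glue_eventually_left:
  fixes b z :: real
  assumes "\<forall>\<^sub>F t in nhds b. h t = g t" and "z \<le> b"
  shows "\<forall>\<^sub>F t in nhds z. (if t \<le> b then g t else h t) = g t"
proof (cases "z = b")
  case True
  show ?thesis
    unfolding True using assms(1) by eventually_elim simp
next
  case False
  then have "\<forall>\<^sub>F t in nhds z. t < b"
    using assms(2) by (intro order_tendstoD(2)[OF filterlim_ident]) simp
  then show ?thesis
    by eventually_elim simp
qed

lemma glue_eventually_right:
  fixes b z :: real
  assumes "\<forall>\<^sub>F t in nhds b. h t = g t" and "b \<le> z"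
  shows "\<forall>\<^sub>F t in nhds z. (if t \<le> b then g t else h t) = h t"
proof (cases "z = b")
  case True
  show ?thesis
    unfolding True using assms(1) by eventually_elim simp
next
  case False
  then have "\<forall>\<^sub>F t in nhds z. b < t"
    using assms(2) by (intro order_tendstoD(1)[OF filterlim_ident]) simp
  then show ?thesis
    by eventually_elim simp
qed

definition root_germ :: "(real \<Rightarrow> real poly) \<Rightarrow> (real \<Rightarrow> real) \<Rightarrow> real \<Rightarrow> bool" where
  "root_germ P f x \<longleftrightarrow> real_analytic_at f x \<and> (\<forall>\<^sub>F t in nhds x. poly (P t) (f t) = 0)"

lemma root_germ_cong:
  assumes "\<forall>\<^sub>F t in nhds x. f t = f' t" and "root_germ P f' x"
  shows "root_germ P f x"
proof -
  have "\<forall>\<^sub>F t in nhds x. poly (P t) (f t) = 0"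
    using assms(1) assms(2)[unfolded root_germ_def, THEN conjunct2] by eventually_elim simp
  then show ?thesis
    using real_analytic_at_cong[OF assms(1)] assms(2) by (simp add: root_germ_def)
qed

lemma root_germ_glue:
  assumes "\<And>z. z \<in> {a..b} \<Longrightarrow> root_germ P g z" and "\<And>z. z \<in> {b..c} \<Longrightarrow> root_germ P h z"
    and "\<forall>\<^sub>F t in nhds b. h t = g t" and "z \<in> {a..c}"
  shows "root_germ P (\<lambda>t. if t \<le> b then g t else h t) z"
proof (cases "z \<le> b")
  case True
  then show ?thesis
    using root_germ_cong[OF glue_eventually_left[OF assms(3) True] assms(1)] assms(4) by simp
next
  case False
  then show ?thesis
    using root_germ_cong[OF glue_eventually_right[OF assms(3), of z] assms(2)] assms(4) by simp
qed

definition analytic_splitting_at :: "nat \<Rightarrow> (real \<Rightarrow> real poly) \<Rightarrow> (nat \<Rightarrow> real \<Rightarrow> real) \<Rightarrow> real \<Rightarrow> bool" where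
  "analytic_splitting_at n P m x \<longleftrightarrow>
     (\<forall>i<n. real_analytic_at (m i) x) \<and> (\<forall>\<^sub>F t in nhds x. P t = (\<Prod>i<n. [:- m i t, 1:]))"

lemma analytic_splitting_at_nearby:
  assumes "analytic_splitting_at n P m x"
  shows "\<forall>\<^sub>F y in nhds x. analytic_splitting_at n P m y"
proof -
  have "\<forall>\<^sub>F y in nhds x. \<forall>i\<in>{..<n}. real_analytic_at (m i) y"
    using assms real_analytic_at_nearby
    by (subst eventually_ball_finite_distrib) (auto simp: analytic_splitting_at_def)
  moreover have "\<forall>\<^sub>F y in nhds x. \<forall>\<^sub>F t in nhds y. P t = (\<Prod>i<n. [:- m i t, 1:])"
    using assms by (simp add: analytic_splitting_at_def eventually_eventually)
  ultimately show ?thesis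
    by eventually_elim (simp add: analytic_splitting_at_def)
qed

lemma poly_split: "poly (\<Prod>i<n. [:- m i, 1:]) y = (\<Prod>i<n. y - (m i :: 'a :: comm_ring_1))"
  by (simp add: poly_prod)

lemma root_germ_of_splitting:
  assumes "analytic_splitting_at n P m x" and "i < n"
  shows "root_germ P (m i) x"
proof -
  have "\<forall>\<^sub>F t in nhds x. poly (P t) (m i t) = 0"
    using assms(1)[unfolded analytic_splitting_at_def, THEN conjunct2]
    by eventually_elim (use assms(2) in \<open>auto simp: poly_split\<close>)
  then show ?thesis
    using assms by (simp add: root_germ_def analytic_splitting_at_def)
qed

text \<open>At each \<open>t\<close> the value \<open>f t\<close> is one of the finitely many \<open>m i t\<close>. If every difference \<open>f - m i\<close>
  had an isolated zero at \<open>x\<close> or none, no index would be available for \<open>t\<close> close to \<open>x\<close>.\<close>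

lemma root_germ_in_splitting:
  assumes "analytic_splitting_at n P m x" and f: "root_germ P f x"
  shows "\<exists>i<n. \<forall>\<^sub>F t in nhds x. f t = m i t"
proof (rule ccontr)
  assume none: "\<not> ?thesis"
  have "\<forall>\<^sub>F t in at x. f t \<noteq> m i t" if "i < n" for i
  proof -
    have "real_analytic_at (\<lambda>t. f t - m i t) x"
      using assms that by (intro real_analytic_at_diff) (auto simp: root_germ_def analytic_splitting_at_def)
    from real_analytic_at_zero_cases[OF this] show ?thesis
      using none that by auto
  qed
  then have "\<forall>\<^sub>F t in at x. \<forall>i\<in>{..<n}. f t \<noteq> m i t"
    by (subst eventually_ball_finite_distrib) auto
  moreover have "\<forall>\<^sub>F t in at x. poly (P t) (f t) = 0"
    using f unfolding root_germ_def by (blast intro: filter_leD[OF at_within_le_nhds])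
  moreover have "\<forall>\<^sub>F t in at x. P t = (\<Prod>i<n. [:- m i t, 1:])"
    using assms(1) unfolding analytic_splitting_at_def by (blast intro: filter_leD[OF at_within_le_nhds])
  ultimately have "\<forall>\<^sub>F t in at x. False"
    by eventually_elim (auto simp: poly_split)
  then show False
    by simp
qed

context
  fixes n :: nat and P :: "real \<Rightarrow> real poly"
  assumes splits: "\<And>x. \<exists>m. analytic_splitting_at n P m x"
begin

text \<open>Near \<open>x\<close> a root germ at any point agrees with one of the functions of the local splitting at \<open>x\<close>,
  and that function extends it over the neighbourhood; Bolzano's interval induction composes these
  extensions. The claim covers extension to the right and to the left, since the base
  point \<open>0\<close> lies in the interior of the line.\<close>

lemma root_germ_continues:
  assumes "a \<le> b"
  shows "(\<forall>f. root_germ P f a \<longrightarrow> (\<exists>g. (\<forall>z\<in>{a..b}. root_germ P g z) \<and> (\<forall>\<^sub>F t in nhds a. g t = f t))) \<and>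
         (\<forall>f. root_germ P f b \<longrightarrow> (\<exists>g. (\<forall>z\<in>{a..b}. root_germ P g z) \<and> (\<forall>\<^sub>F t in nhds b. g t = f t)))"
  using assms
proof (induction a b rule: Bolzano)
  case (trans a b c)
  show ?case
  proof (intro conjI allI impI)
    fix f assume "root_germ P f a"
    then obtain g where g: "\<forall>z\<in>{a..b}. root_germ P g z" "\<forall>\<^sub>F t in nhds a. g t = f t"
      using trans.IH(1) by blast
    then have "root_germ P g b"
      using \<open>a \<le> b\<close> by simp
    then obtain h where h: "\<forall>z\<in>{b..c}. root_germ P h z" "\<forall>\<^sub>F t in nhds b. h t = g t"
      using trans.IH(2) by blast
    define k where "k = (\<lambda>t. if t \<le> b then g t else h t)"
    have "\<forall>z\<in>{a..c}. root_germ P k z"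
      using root_germ_glue[of a b P g c h] g(1) h unfolding k_def by blast
    moreover have "\<forall>\<^sub>F t in nhds a. k t = f t"
      using glue_eventually_left[OF h(2) \<open>a \<le> b\<close>] g(2) unfolding k_def by eventually_elim simp
    ultimately show "\<exists>k. (\<forall>z\<in>{a..c}. root_germ P k z) \<and> (\<forall>\<^sub>F t in nhds a. k t = f t)"
      by blast
  next
    fix f assume "root_germ P f c"
    then obtain h where h: "\<forall>z\<in>{b..c}. root_germ P h z" "\<forall>\<^sub>F t in nhds c. h t = f t"
      using trans.IH(2) by blast
    then have "root_germ P h b"
      using \<open>b \<le> c\<close> by simp
    then obtain g where g: "\<forall>z\<in>{a..b}. root_germ P g z" "\<forall>\<^sub>F t in nhds b. g t = h t"
      using trans.IH(1) by blast
    have hg: "\<forall>\<^sub>F t in nhds b. h t = g t"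
      using g(2) by eventually_elim simp
    define k where "k = (\<lambda>t. if t \<le> b then g t else h t)"
    have "\<forall>z\<in>{a..c}. root_germ P k z"
      using root_germ_glue[of a b P g c h] g(1) h(1) hg unfolding k_def by blast
    moreover have "\<forall>\<^sub>F t in nhds c. k t = f t"
      using glue_eventually_right[OF hg \<open>b \<le> c\<close>] h(2) unfolding k_def by eventually_elim simp
    ultimately show "\<exists>k. (\<forall>z\<in>{a..c}. root_germ P k z) \<and> (\<forall>\<^sub>F t in nhds c. k t = f t)"
      by blast
  qed
next
  case (local x)
  obtain m where "analytic_splitting_at n P m x"
    using splits by blast
  from analytic_splitting_at_nearby[OF this]
  obtain d where "d > 0" and d: "\<And>y. dist y x < d \<Longrightarrow> analytic_splitting_at n P m y"
    by (auto simp: eventually_nhds_metric)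
  have ext: "\<exists>g. (\<forall>z\<in>{a..b}. root_germ P g z) \<and> (\<forall>\<^sub>F t in nhds y. g t = f t)"
    if "a \<le> x" "x \<le> b" "b - a < d" and y: "y \<in> {a..b}" and f: "root_germ P f y" for a b y f
  proof -
    have near: "analytic_splitting_at n P m z" if "z \<in> {a..b}" for z
      using that \<open>a \<le> x\<close> \<open>x \<le> b\<close> \<open>b - a < d\<close> by (intro d) (auto simp: dist_real_def)
    obtain i where "i < n" "\<forall>\<^sub>F t in nhds y. f t = m i t"
      using root_germ_in_splitting[OF near[OF y] f] by blast
    then have "\<forall>\<^sub>F t in nhds y. m i t = f t"
      by (elim eventually_mono) simp
    moreover have "\<forall>z\<in>{a..b}. root_germ P (m i) z"
      using root_germ_of_splitting[OF near \<open>i < n\<close>] by blast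
    ultimately show ?thesis
      by blast
  qed
  show ?case
    by (rule exI[of _ d], intro conjI \<open>d > 0\<close> allI impI) (auto intro: ext)
qed

text \<open>The continuations to \<open>{-T..T}\<close> for different \<open>T\<close> agree where both are defined, by the identity
  theorem, so the function that uses \<open>T = \<bar>t\<bar> + 1\<close> at \<open>t\<close> is locally one of them.\<close>

lemma root_germ_global:
  assumes f: "root_germ P f 0"
  shows "\<exists>g. (\<forall>z. root_germ P g z) \<and> (\<forall>\<^sub>F t in nhds 0. g t = f t)"
proof -
  have "\<exists>k. (\<forall>z\<in>{-T..T}. root_germ P k z) \<and> (\<forall>\<^sub>F t in nhds 0. k t = f t)" if "T \<ge> 0" for T
  proof -
    obtain g where g: "\<forall>z\<in>{-T..0}. root_germ P g z" "\<forall>\<^sub>F t in nhds 0. g t = f t"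
      using root_germ_continues[of "-T" 0] f \<open>T \<ge> 0\<close> by auto
    obtain h where h: "\<forall>z\<in>{0..T}. root_germ P h z" "\<forall>\<^sub>F t in nhds 0. h t = f t"
      using root_germ_continues[of 0 T] f \<open>T \<ge> 0\<close> by blast
    have hg: "\<forall>\<^sub>F t in nhds 0. h t = g t"
      using g(2) h(2) by eventually_elim simp
    define k where "k = (\<lambda>t. if t \<le> 0 then g t else h t)"
    have "\<forall>z\<in>{-T..T}. root_germ P k z"
      using root_germ_glue[of "-T" 0 P g T h] g(1) h(1) hg unfolding k_def by blast
    moreover have "\<forall>\<^sub>F t in nhds 0. k t = f t"
      using g(2) h(2) unfolding k_def by eventually_elim simp
    ultimately show ?thesis
      by blast
  qed
  then obtain K where K: "\<And>T z. T \<ge> 0 \<Longrightarrow> z \<in> {-T..T} \<Longrightarrow> root_germ P (K T) z"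
      "\<And>T. T \<ge> 0 \<Longrightarrow> \<forall>\<^sub>F t in nhds 0. K T t = f t"
    by metis
  have agree: "K S t = K T t" if "0 \<le> S" "S \<le> T" "\<bar>t\<bar> \<le> S" for S T t
  proof -
    define D where "D = (\<lambda>t. K S t - K T t)"
    have an: "real_analytic_at D z" if "\<bar>z\<bar> \<le> S" for z
    proof -
      have "z \<in> {-S..S}" "z \<in> {-T..T}" "0 \<le> T"
        using that \<open>0 \<le> S\<close> \<open>S \<le> T\<close> by auto
      then show ?thesis
        using K(1)[of S z] K(1)[of T z] \<open>0 \<le> S\<close>
        unfolding D_def by (intro real_analytic_at_diff) (simp_all add: root_germ_def)
    qed
    have "\<forall>\<^sub>F t in nhds 0. D t = 0"
      using K(2)[of S] K(2)[of T] \<open>0 \<le> S\<close> \<open>S \<le> T\<close>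
      unfolding D_def by (auto elim: eventually_elim2)
    then have "\<forall>\<^sub>F u in nhds t. D u = 0"
      using real_analytic_zero_propagates[of 0 t D] real_analytic_zero_propagates[of t 0 D]
        an \<open>\<bar>t\<bar> \<le> S\<close> by (cases "0 \<le> t") auto
    then have "D t = 0"
      by (rule eventually_nhds_x_imp_x)
    then show ?thesis
      by (simp add: D_def)
  qed
  define g where "g = (\<lambda>t. K (\<bar>t\<bar> + 1) t)"
  have g: "\<forall>\<^sub>F t in nhds x. g t = K (\<bar>x\<bar> + 2) t" for x
  proof -
    have "\<forall>\<^sub>F t in nhds x. t \<in> ball x 1"
      by (intro eventually_nhds_in_open) auto
    then show ?thesis
      by eventually_elim (auto simp: g_def dist_real_def intro!: agree)
  qed
  have "root_germ P g z" for z
    by (rule root_germ_cong[OF g K(1)]) auto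
  moreover have "\<forall>\<^sub>F t in nhds 0. g t = f t"
  proof -
    have "\<forall>\<^sub>F t in nhds 0. g t = K 2 t"
      using g[of 0] by simp
    then show ?thesis
      using K(2)[OF zero_le_numeral, of "num.Bit0 num.One"] by eventually_elim simp
  qed
  ultimately show ?thesis
    by blast
qed

text \<open>Each function of the splitting at \<open>0\<close> is continued separately. Multiplicities need no bookkeeping:
  for every \<open>y\<close> the difference of both sides, evaluated at \<open>y\<close>, is analytic in \<open>t\<close> and vanishes
  near \<open>0\<close>, hence it vanishes everywhere.\<close>

lemma global_analytic_splitting:
  "\<exists>l. (\<forall>i<n. \<forall>x. real_analytic_at (l i) x) \<and> (\<forall>t. P t = (\<Prod>i<n. [:- l i t, 1:]))"
proof -
  obtain m where m: "analytic_splitting_at n P m 0"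
    using splits by blast
  have "\<exists>g. (\<forall>z. root_germ P g z) \<and> (\<forall>\<^sub>F t in nhds 0. g t = m i t)" if "i < n" for i
    by (rule root_germ_global[OF root_germ_of_splitting[OF m that]])
  then obtain l where l: "\<And>i z. i < n \<Longrightarrow> root_germ P (l i) z"
      "\<And>i. i < n \<Longrightarrow> \<forall>\<^sub>F t in nhds 0. l i t = m i t"
    by metis
  have l_an: "real_analytic_at (l i) x" if "i < n" for i x
    using l(1)[OF that] by (simp add: root_germ_def)
  have "poly (P t) y = poly (\<Prod>i<n. [:- l i t, 1:]) y" for t y
  proof -
    define D where "D = (\<lambda>t. poly (P t) y - (\<Prod>i<n. y - l i t))"
    have "real_analytic_at D x" for x
    proof -
      obtain m where m: "analytic_splitting_at n P m x"
        using splits by blast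
      have "real_analytic_at (\<lambda>t. \<Prod>i<n. y - m i t) x"
        using m by (intro real_analytic_at_prod real_analytic_at_diff real_analytic_at_const)
          (simp add: analytic_splitting_at_def)
      moreover have "\<forall>\<^sub>F t in nhds x. poly (P t) y = (\<Prod>i<n. y - m i t)"
        using m[unfolded analytic_splitting_at_def, THEN conjunct2]
        by eventually_elim (simp add: poly_split)
      ultimately have "real_analytic_at (\<lambda>t. poly (P t) y) x"
        by (rule real_analytic_at_cong[rotated])
      then show ?thesis
        unfolding D_def
        by (intro real_analytic_at_prod real_analytic_at_diff real_analytic_at_const l_an) simp_all
    qed
    moreover have "\<forall>\<^sub>F t in nhds 0. D t = 0"
    proof -
      have "\<forall>\<^sub>F t in nhds 0. \<forall>i\<in>{..<n}. l i t = m i t"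
        using l(2) by (subst eventually_ball_finite_distrib) auto
      with m[unfolded analytic_splitting_at_def, THEN conjunct2] show ?thesis
        by eventually_elim (simp add: D_def poly_split)
    qed
    ultimately have "D t = 0"
      by (rule real_analytic_identity)
    then show ?thesis
      by (simp add: D_def poly_split)
  qed
  then have "P t = (\<Prod>i<n. [:- l i t, 1:])" for t
    using poly_eq_poly_eq_iff by blast
  then show ?thesis
    using l_an by blast
qed

end

text \<open>The roots at real parameters are real, so replacing the complex root functions by their real
  parts does not change them on the real line.\<close>

lemma analytic_splitting_at_real_point:
  fixes p :: "complex \<Rightarrow> complex poly" and P :: "real \<Rightarrow> real poly"
  assumes deg: "\<And>z. degree (p z) \<le> n" and lead: "\<And>z. coeff (p z) n = 1"
    and an: "\<And>z j. (\<lambda>z. coeff (p z) j) analytic_on {z}"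
    and pP: "\<And>t y. poly (p (of_real t)) (of_real y) = of_real (poly (P t) y)"
    and rr: "\<And>t y. poly (p (of_real t)) y = 0 \<Longrightarrow> y \<in> \<real>"
  shows "\<exists>m. analytic_splitting_at n P m x"
proof -
  define q where "q = (\<lambda>s. p (of_real x + s))"
  have "(\<lambda>s. coeff (q s) j) analytic_on {0}" for j
  proof -
    have "((\<lambda>z. coeff (p z) j) \<circ> (\<lambda>s. of_real x + s)) analytic_on {0}"
      by (rule analytic_on_compose) (auto intro!: analytic_intros an)
    then show ?thesis
      by (simp add: q_def o_def)
  qed
  then have fam: "analytic_family n q"
    using deg by (simp add: analytic_family_def q_def)
  have "real_rooted_near_0 q"
    unfolding real_rooted_near_0_def
    by (rule always_eventually) (use rr in \<open>auto simp: q_def elim!: Reals_cases simp flip: of_real_add\<close>)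
  then obtain m where m: "\<forall>i<n. m i analytic_on {0}"
    and split: "\<forall>\<^sub>F s in nhds 0. q s = (\<Prod>i<n. [:- m i s, 1:])"
    using analytic_splitting[OF fam] lead unfolding q_def by blast
  have lim: "filterlim (\<lambda>t. complex_of_real (t - x)) (nhds 0) (nhds x)"
  proof -
    have "((\<lambda>t. complex_of_real (t - x)) \<longlongrightarrow> of_real (x - x)) (nhds x)"
      by (intro tendsto_intros filterlim_ident)
    then show ?thesis by simp
  qed
  define r where "r = (\<lambda>i t. Re (m i (of_real (t - x))))"
  have ev: "\<forall>\<^sub>F t in nhds x. p (of_real t) = (\<Prod>i<n. [:- m i (of_real (t - x)), 1:])"
    using eventually_compose_filterlim[OF split lim] by eventually_elim (simp add: q_def)
  have real: "\<forall>\<^sub>F t in nhds x. \<forall>i<n. of_real (r i t) = m i (of_real (t - x))"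
    using ev
  proof eventually_elim
    case (elim t)
    have "m i (of_real (t - x)) \<in> \<real>" if "i < n" for i
      by (rule rr[of t]) (use that in \<open>auto simp: elim poly_split\<close>)
    then show ?case
      by (simp add: r_def)
  qed
  have "real_analytic_at (r i) x" if "i < n" for i
    unfolding real_analytic_at_def
  proof (intro exI conjI)
    have "(m i \<circ> (\<lambda>z. z - of_real x)) analytic_on {of_real x}"
      by (rule analytic_on_compose) (use m that in \<open>auto intro!: analytic_intros\<close>)
    then show "(\<lambda>z. m i (z - of_real x)) analytic_on {of_real x}"
      by (simp add: o_def)
    show "\<forall>\<^sub>F t in nhds x. of_real (r i t) = m i (of_real t - of_real x)"
      using real by eventually_elim (use that in simp)
  qed
  moreover have "\<forall>\<^sub>F t in nhds x. P t = (\<Prod>i<n. [:- r i t, 1:])"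
    using ev real
  proof eventually_elim
    case (elim t)
    have "of_real (poly (P t) y) = (of_real (poly (\<Prod>i<n. [:- r i t, 1:]) y) :: complex)" for y
      unfolding pP[symmetric] elim(1) poly_split using elim(2) by simp
    then have "poly (P t) = poly (\<Prod>i<n. [:- r i t, 1:])"
      by (intro ext) (simp only: of_real_eq_iff)
    then show ?case
      by (simp only: poly_eq_poly_eq_iff)
  qed
  ultimately show ?thesis
    unfolding analytic_splitting_at_def by blast
qed

section \<open>Eigenvalues over integral domains and of real symmetric matrices\<close>

text \<open>Over an arbitrary integral domain, because it is applied to complex matrices and to matrices of
  formal power series.\<close>

lemma char_poly_root_imp_kernel_vector:
  fixes M :: "'a :: idom mat"
  assumes M: "M \<in> carrier_mat n n" and root: "poly (char_poly M) x = 0"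
  shows "\<exists>v. (\<exists>i<n. v i \<noteq> 0) \<and> (\<forall>i<n. (\<Sum>j<n. M $$ (i, j) * v j) = x * v i)"
proof -
  define N where "N = mat n n (\<lambda>(i, j). (if i = j then x else 0) - M $$ (i, j))"
  have N: "N \<in> carrier_mat n n"
    by (simp add: N_def)
  have "poly (Determinant.det (char_poly_matrix M)) x = Determinant.det N"
    by (rule poly_det_cong[OF N char_poly_matrix_closed[OF M]])
      (use M in \<open>auto simp: N_def char_poly_matrix_def\<close>)
  then have "Determinant.det N = 0"
    using root by (simp add: char_poly_def)
  then obtain v where v: "v \<in> carrier_vec n" "v \<noteq> 0\<^sub>v n" "N *\<^sub>v v = 0\<^sub>v n"
    using det_0_iff_vec_prod_zero[OF N] by blast
  have "\<exists>i<n. v $ i \<noteq> 0"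
  proof (rule ccontr)
    assume "\<not> ?thesis"
    then have "v = 0\<^sub>v n"
      using v(1) by (intro eq_vecI) auto
    then show False
      using v(2) by simp
  qed
  moreover have "(\<Sum>j<n. M $$ (i, j) * v $ j) = x * v $ i" if i: "i < n" for i
  proof -
    have "0 = (N *\<^sub>v v) $ i"
      using v(3) i by simp
    also have "\<dots> = (\<Sum>j<n. N $$ (i, j) * v $ j)"
      using i N v(1) by (simp add: scalar_prod_def atLeast0LessThan)
    also have "\<dots> = (\<Sum>j<n. (if i = j then x * v $ j else 0) - M $$ (i, j) * v $ j)"
      using i by (intro sum.cong) (auto simp: N_def left_diff_distrib)
    also have "\<dots> = x * v $ i - (\<Sum>j<n. M $$ (i, j) * v $ j)"
      using i by (simp add: sum_subtractf)
    finally show ?thesis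
      by simp
  qed
  ultimately show ?thesis
    by blast
qed

lemma sym_mats_entries:
  assumes "M \<in> sym_mats n" and "i < n" and "j < n"
  shows "M $$ (i, j) = M $$ (j, i)"
proof -
  have "M \<in> carrier_mat n n" and "transpose_mat M = M"
    using assms(1) by (simp_all add: sym_mats_def)
  then show ?thesis
    using assms(2,3) by (metis carrier_matD index_transpose_mat(1))
qed

text \<open>For an eigenvector \<open>v\<close>, symmetry makes \<open>S = v\<^sup>* M v\<close> equal to its own conjugate, and
  \<open>S = z \<parallel>v\<parallel>\<^sup>2\<close>.\<close>

lemma char_poly_root_real:
  fixes M :: "real mat"
  assumes M: "M \<in> sym_mats n" and root: "poly (map_poly of_real (char_poly M)) (z :: complex) = 0"
  shows "z \<in> \<real>"
proof -
  have Mc: "M \<in> carrier_mat n n"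
    using M by (simp add: sym_mats_def)
  note sym = sym_mats_entries[OF M]
  have "char_poly (map_mat complex_of_real M) = map_poly of_real (char_poly M)"
    by (rule of_real_hom.char_poly_hom[OF Mc])
  then have "poly (char_poly (map_mat complex_of_real M)) z = 0"
    using root by simp
  from char_poly_root_imp_kernel_vector[OF _ this, of n] obtain v
    where v: "\<exists>i<n. v i \<noteq> 0"
      and eig: "\<And>i. i < n \<Longrightarrow> (\<Sum>j<n. map_mat complex_of_real M $$ (i, j) * v j) = z * v i"
    using Mc by auto
  have eig': "(\<Sum>j<n. complex_of_real (M $$ (i, j)) * v j) = z * v i" if "i < n" for i
    unfolding eig[OF that, symmetric] using that Mc by (intro sum.cong) auto
  define S where "S = (\<Sum>i<n. \<Sum>j<n. complex_of_real (M $$ (i, j)) * (v j * cnj (v i)))"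
  define R where "R = (\<Sum>i<n. (norm (v i))\<^sup>2)"
  have "S = (\<Sum>i<n. cnj (v i) * (\<Sum>j<n. complex_of_real (M $$ (i, j)) * v j))"
    by (simp add: S_def sum_distrib_left mult_ac)
  also have "\<dots> = (\<Sum>i<n. z * of_real ((norm (v i))\<^sup>2))"
  proof (intro sum.cong refl)
    fix i assume "i \<in> {..<n}"
    then have "cnj (v i) * (\<Sum>j<n. complex_of_real (M $$ (i, j)) * v j) = cnj (v i) * (z * v i)"
      by (simp only: eig' lessThan_iff)
    also have "\<dots> = z * of_real ((norm (v i))\<^sup>2)"
      by (simp only: complex_norm_square mult_ac)
    finally show "cnj (v i) * (\<Sum>j<n. complex_of_real (M $$ (i, j)) * v j)
        = z * of_real ((norm (v i))\<^sup>2)" .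
  qed
  also have "\<dots> = z * of_real R"
    by (simp add: R_def sum_distrib_left)
  finally have SR: "S = z * of_real R" .
  have "cnj S = (\<Sum>i<n. \<Sum>j<n. complex_of_real (M $$ (i, j)) * (v i * cnj (v j)))"
    by (simp add: S_def mult_ac)
  also have "\<dots> = (\<Sum>j<n. \<Sum>i<n. complex_of_real (M $$ (i, j)) * (v i * cnj (v j)))"
    by (rule sum.swap)
  also have "\<dots> = S"
    unfolding S_def by (intro sum.cong refl) (simp add: sym)
  finally have "S \<in> \<real>"
    by (simp add: Reals_cnj_iff)
  moreover have "R > 0"
    using v unfolding R_def by (auto intro!: sum_pos2)
  ultimately have "S / of_real R \<in> \<real>"
    by (intro Reals_divide) auto
  then show ?thesis
    using SR \<open>R > 0\<close> by simp
qed

section \<open>The order of vanishing of an eigenvalue\<close>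

text \<open>A zero \<open>v\<close> of a nonnegative quadratic form is a minimum, so its gradient \<open>2 a v\<close> vanishes. Concretely, with
  \<open>z = a v\<close> the form takes the value \<open>2 s \<parallel>z\<parallel>\<^sup>2 + s\<^sup>2 q\<close> at \<open>v + s z\<close>, which is negative for a suitable
  \<open>s < 0\<close> unless \<open>z = 0\<close>.\<close>

lemma psd_form_zero_imp_kernel:
  fixes a :: "nat \<Rightarrow> nat \<Rightarrow> real"
  assumes sym: "\<And>i j. i < n \<Longrightarrow> j < n \<Longrightarrow> a i j = a j i"
    and psd: "\<And>x. 0 \<le> (\<Sum>i<n. x i * (\<Sum>j<n. a i j * x j))"
    and zero: "(\<Sum>i<n. v i * (\<Sum>j<n. a i j * v j)) = 0" and "k < n"
  shows "(\<Sum>j<n. a k j * v j) = 0"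
proof (rule ccontr)
  assume k: "(\<Sum>j<n. a k j * v j) \<noteq> 0"
  define z where "z = (\<lambda>i. \<Sum>j<n. a i j * v j)"
  define N where "N = (\<Sum>i<n. z i * z i)"
  define q where "q = (\<Sum>i<n. z i * (\<Sum>j<n. a i j * z j))"
  have "N > 0"
    unfolding N_def using k \<open>k < n\<close> by (intro sum_pos2[of _ k]) (auto simp: z_def zero_less_mult_iff)
  have "q \<ge> 0"
    unfolding q_def by (rule psd)
  have vz: "(\<Sum>i<n. v i * (\<Sum>j<n. a i j * z j)) = N"
  proof -
    have "(\<Sum>i<n. v i * (\<Sum>j<n. a i j * z j)) = (\<Sum>i<n. \<Sum>j<n. v i * (a i j * z j))"
      by (simp add: sum_distrib_left)
    also have "\<dots> = (\<Sum>j<n. \<Sum>i<n. v i * (a i j * z j))"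
      by (rule sum.swap)
    also have "\<dots> = (\<Sum>j<n. z j * (\<Sum>i<n. a j i * v i))"
      unfolding sum_distrib_left by (intro sum.cong refl) (simp add: sym mult_ac)
    finally show ?thesis
      by (simp add: N_def z_def)
  qed
  define s where "s = - N / (q + 1)"
  have "(\<Sum>i<n. (v i + s * z i) * (\<Sum>j<n. a i j * (v j + s * z j)))
      = (\<Sum>i<n. v i * z i + s * (z i * z i) + s * (v i * (\<Sum>j<n. a i j * z j))
          + s\<^sup>2 * (z i * (\<Sum>j<n. a i j * z j)))"
  proof (intro sum.cong refl)
    fix i
    have "(\<Sum>j<n. a i j * (v j + s * z j)) = z i + s * (\<Sum>j<n. a i j * z j)"
      by (simp add: z_def distrib_left sum.distrib sum_distrib_left mult_ac)
    then show "(v i + s * z i) * (\<Sum>j<n. a i j * (v j + s * z j))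
      = v i * z i + s * (z i * z i) + s * (v i * (\<Sum>j<n. a i j * z j))
          + s\<^sup>2 * (z i * (\<Sum>j<n. a i j * z j))"
      by (simp add: algebra_simps power2_eq_square)
  qed
  also have "\<dots> = (\<Sum>i<n. v i * z i) + s * N + s * N + s\<^sup>2 * q"
    by (simp add: sum.distrib N_def q_def vz[unfolded N_def] flip: sum_distrib_left)
  also have "(\<Sum>i<n. v i * z i) = 0"
    using zero by (simp add: z_def)
  finally have "0 \<le> 2 * s * N + s\<^sup>2 * q"
    using psd[of "\<lambda>i. v i + s * z i"] by (simp add: mult_ac)
  also have "\<dots> = - (s\<^sup>2 * (q + 2))"
  proof -
    have N: "N = - s * (q + 1)"
      using \<open>q \<ge> 0\<close> by (simp add: s_def)
    show ?thesis
      unfolding N by (simp add: algebra_simps power2_eq_square)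
  qed
  also have "\<dots> < 0"
  proof -
    have "s \<noteq> 0"
      using \<open>q \<ge> 0\<close> \<open>N > 0\<close> by (simp add: s_def)
    then show ?thesis
      using \<open>q \<ge> 0\<close> by simp
  qed
  finally show False
    by simp
qed

lemma fps_const_sum: "fps_const (\<Sum>i\<in>I. f i) = (\<Sum>i\<in>I. fps_const (f i :: 'a :: comm_ring_1))"
  by (induction I rule: infinite_finite_induct) (simp_all flip: fps_const_add)

text \<open>Suppose \<open>F = O(t\<^sup>3)\<close> and write \<open>u = v\<^sub>0 + v\<^sub>1 t + v\<^sub>2 t\<^sup>2 + \<dots>\<close> for the eigenvector. The terms of degree
  at most two give \<open>a v\<^sub>0 = 0\<close>, \<open>a v\<^sub>1 + b v\<^sub>0 = 0\<close> and \<open>a v\<^sub>2 + b v\<^sub>1 = 0\<close>. By symmetry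
  \<open>v\<^sub>1 \<bullet> a v\<^sub>1 = - v\<^sub>1 \<bullet> b v\<^sub>0 = - v\<^sub>0 \<bullet> b v\<^sub>1 = v\<^sub>0 \<bullet> a v\<^sub>2 = v\<^sub>2 \<bullet> a v\<^sub>0 = 0\<close>, so positive
  semidefiniteness yields \<open>a v\<^sub>1 = 0\<close> and hence \<open>b v\<^sub>0 = 0\<close>. Thus \<open>v\<^sub>0\<close> is annihilated by \<open>a + t b\<close>, and
  taking the inner product of the eigenvalue equation with \<open>v\<^sub>0\<close> gives \<open>F (v\<^sub>0 \<bullet> u) = 0\<close>. If \<open>F \<noteq> 0\<close>,
  the constant term \<open>v\<^sub>0 \<bullet> v\<^sub>0\<close> of the second factor vanishes, although \<open>v\<^sub>0 \<noteq> 0\<close>.\<close>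

lemma formal_eigenvalue_subdegree:
  fixes a b :: "nat \<Rightarrow> nat \<Rightarrow> real" and u :: "nat \<Rightarrow> real fps"
  assumes sym_a: "\<And>i j. i < n \<Longrightarrow> j < n \<Longrightarrow> a i j = a j i"
    and sym_b: "\<And>i j. i < n \<Longrightarrow> j < n \<Longrightarrow> b i j = b j i"
    and psd: "\<And>x. 0 \<le> (\<Sum>i<n. x i * (\<Sum>j<n. a i j * x j))"
    and eig: "\<And>i. i < n \<Longrightarrow> (\<Sum>j<n. (fps_const (a i j) + fps_const (b i j) * fps_X) * u j) = F * u i"
    and "i0 < n" "fps_nth (u i0) 0 \<noteq> 0" and "F \<noteq> 0"
  shows "subdegree F \<le> 2"
proof (rule ccontr)
  assume "\<not> ?thesis"
  then have F_low: "fps_nth F k = 0" if "k \<le> 2" for k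
    using that by (intro nth_less_subdegree_zero) simp
  have coeff: "(\<Sum>j<n. a i j * (fps_nth (u j) k)) + (\<Sum>j<n. b i j * (if k = 0 then 0 else fps_nth (u j) (k - 1))) = 0"
    if "i < n" "k \<le> 2" for i k
  proof -
    have "fps_nth (\<Sum>j<n. (fps_const (a i j) + fps_const (b i j) * fps_X) * u j) k = fps_nth (F * u i) k"
      using eig[OF \<open>i < n\<close>] by simp
    also have "fps_nth (F * u i) k = 0"
      unfolding fps_mult_nth using F_low \<open>k \<le> 2\<close> by (intro sum.neutral) auto
    also have "fps_nth (\<Sum>j<n. (fps_const (a i j) + fps_const (b i j) * fps_X) * u j) k
        = (\<Sum>j<n. a i j * (fps_nth (u j) k) + b i j * (if k = 0 then 0 else fps_nth (u j) (k - 1)))"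
      by (simp add: fps_sum_nth distrib_right mult.assoc)
    finally show ?thesis
      by (simp add: sum.distrib)
  qed
  define v where "v = (\<lambda>k j. fps_nth (u j) k)"
  define Aop where "Aop = (\<lambda>x i. \<Sum>j<n. a i j * x j)"
  define Bop where "Bop = (\<lambda>x i. \<Sum>j<n. b i j * x j)"
  have swap: "(\<Sum>i<n. x i * (\<Sum>j<n. c i j * y j)) = (\<Sum>i<n. y i * (\<Sum>j<n. c i j * x j))"
    if "\<And>i j. i < n \<Longrightarrow> j < n \<Longrightarrow> c i j = c j i" for c and x y :: "nat \<Rightarrow> real"
  proof -
    have "(\<Sum>i<n. x i * (\<Sum>j<n. c i j * y j)) = (\<Sum>i<n. \<Sum>j<n. x i * (c i j * y j))"
      by (simp add: sum_distrib_left)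
    also have "\<dots> = (\<Sum>j<n. \<Sum>i<n. x i * (c i j * y j))"
      by (rule sum.swap)
    also have "\<dots> = (\<Sum>j<n. y j * (\<Sum>i<n. c j i * x i))"
      unfolding sum_distrib_left by (intro sum.cong refl) (simp add: that mult_ac)
    finally show ?thesis .
  qed
  have A0: "Aop (v 0) i = 0" if "i < n" for i
    using coeff[OF that, of 0] by (simp add: Aop_def v_def)
  have A1: "Aop (v 1) i + Bop (v 0) i = 0" if "i < n" for i
    using coeff[OF that, of 1] by (simp add: Aop_def Bop_def v_def)
  have A2: "Aop (v 2) i + Bop (v 1) i = 0" if "i < n" for i
    using coeff[OF that, of 2] by (simp add: Aop_def Bop_def v_def)
  have "(\<Sum>i<n. v 1 i * Aop (v 1) i) = (\<Sum>i<n. - (v 1 i * Bop (v 0) i))"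
  proof (intro sum.cong refl)
    fix i assume "i \<in> {..<n}"
    then have "Aop (v 1) i = - Bop (v 0) i"
      using A1[of i] by simp
    then show "v 1 i * Aop (v 1) i = - (v 1 i * Bop (v 0) i)"
      by simp
  qed
  also have "\<dots> = - (\<Sum>i<n. v 0 i * Bop (v 1) i)"
    using swap[of b "v 1" "v 0", OF sym_b] by (simp add: Bop_def sum_negf)
  also have "\<dots> = (\<Sum>i<n. v 0 i * Aop (v 2) i)"
    unfolding sum_negf[symmetric]
  proof (intro sum.cong refl)
    fix i assume "i \<in> {..<n}"
    then have "Bop (v 1) i = - Aop (v 2) i"
      using A2[of i] by simp
    then show "- (v 0 i * Bop (v 1) i) = v 0 i * Aop (v 2) i"
      by simp
  qed
  also have "\<dots> = (\<Sum>i<n. v 2 i * Aop (v 0) i)"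
    using swap[of a "v 0" "v 2", OF sym_a] by (simp add: Aop_def)
  also have "\<dots> = 0"
    by (simp add: A0)
  finally have "Aop (v 1) i = 0" if "i < n" for i
    using psd_form_zero_imp_kernel[of n a "v 1" i, OF sym_a psd _ that] by (simp add: Aop_def)
  then have B0: "Bop (v 0) i = 0" if "i < n" for i
    using A1[OF that] that by simp
  define c where "c = (\<lambda>i j. fps_const (a i j) + fps_const (b i j) * fps_X)"
  have col: "(\<Sum>i<n. fps_const (v 0 i) * c i j) = 0" if "j < n" for j
  proof -
    have "(\<Sum>i<n. fps_const (v 0 i) * c i j)
        = fps_const (\<Sum>i<n. a j i * v 0 i) + fps_const (\<Sum>i<n. b j i * v 0 i) * fps_X"
      unfolding fps_const_sum sum_distrib_right sum.distrib[symmetric]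
    proof (intro sum.cong refl)
      fix i assume "i \<in> {..<n}"
      then have sym: "a i j = a j i" "b i j = b j i"
        using sym_a[of i j] sym_b[of i j] that by simp_all
      show "fps_const (v 0 i) * c i j = fps_const (a j i * v 0 i) + fps_const (b j i * v 0 i) * fps_X"
        unfolding c_def sym
        by (simp add: distrib_left mult.commute[of "v 0 i"] flip: mult.assoc)
    qed
    also have "\<dots> = 0"
      using A0[OF that] B0[OF that] by (simp add: Aop_def Bop_def)
    finally show ?thesis .
  qed
  have "F * (\<Sum>i<n. fps_const (v 0 i) * u i) = (\<Sum>i<n. fps_const (v 0 i) * (\<Sum>j<n. c i j * u j))"
    unfolding sum_distrib_left[of F]
  proof (intro sum.cong refl)
    fix i assume "i \<in> {..<n}"
    then have "(\<Sum>j<n. c i j * u j) = F * u i"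
      unfolding c_def by (intro eig) simp
    then show "F * (fps_const (v 0 i) * u i) = fps_const (v 0 i) * (\<Sum>j<n. c i j * u j)"
      by (simp only: mult_ac)
  qed
  also have "\<dots> = (\<Sum>i<n. \<Sum>j<n. fps_const (v 0 i) * c i j * u j)"
    by (simp add: sum_distrib_left mult.assoc)
  also have "\<dots> = (\<Sum>j<n. (\<Sum>i<n. fps_const (v 0 i) * c i j) * u j)"
    unfolding sum_distrib_right by (rule sum.swap)
  also have "\<dots> = 0"
    by (simp add: col)
  finally have "(\<Sum>i<n. fps_const (v 0 i) * u i) = 0"
    using \<open>F \<noteq> 0\<close> by simp
  then have "fps_nth (\<Sum>i<n. fps_const (v 0 i) * u i) 0 = 0"
    by simp
  then have "(\<Sum>i<n. v 0 i * v 0 i) = 0"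
    by (simp add: fps_sum_nth v_def)
  moreover have "(\<Sum>i<n. v 0 i * v 0 i) > 0"
    using \<open>i0 < n\<close> \<open>fps_nth (u i0) 0 \<noteq> 0\<close>
    by (intro sum_pos2[of _ i0]) (auto simp: v_def zero_less_mult_iff)
  ultimately show False
    by simp
qed

text \<open>Used to normalise a formal eigenvector so that its constant term is nonzero: the common power of
  \<open>X\<close> is the least order of vanishing of a nonzero entry.\<close>

lemma formal_vector_primitive_part:
  fixes w :: "nat \<Rightarrow> real fps"
  assumes "\<exists>i<n. w i \<noteq> 0"
  shows "\<exists>m u. (\<forall>i<n. w i = fps_X ^ m * u i) \<and> (\<exists>i<n. fps_nth (u i) 0 \<noteq> 0)"
proof -
  define I where "I = {i. i < n \<and> w i \<noteq> 0}"
  define m where "m = Min ((\<lambda>i. subdegree (w i)) ` I)"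
  have I: "finite I" "I \<noteq> {}"
    using assms by (auto simp: I_def)
  have "m \<in> (\<lambda>i. subdegree (w i)) ` I"
    unfolding m_def using I by (intro Min_in) auto
  then obtain i0 where i0: "i0 \<in> I" "m = subdegree (w i0)"
    by blast
  have le: "m \<le> subdegree (w i)" if "i \<in> I" for i
    unfolding m_def using I that by (intro Min_le) auto
  define u where "u = (\<lambda>i. fps_shift m (w i))"
  have "w i = fps_X ^ m * u i" if "i < n" for i
  proof (cases "w i = 0")
    case False
    then have "m \<le> subdegree (w i)"
      using le that by (simp add: I_def)
    then show ?thesis
      using fps_shift_times_fps_X_power[of m "w i"] by (simp only: u_def mult.commute)
  qed (simp add: u_def)
  moreover have "fps_nth (u i0) 0 \<noteq> 0" "i0 < n"
    using i0 by (simp_all add: u_def I_def)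
  ultimately show ?thesis
    by blast
qed

section \<open>The spectrum of a symmetric pencil\<close>

lemma has_fps_expansion_poly:
  fixes q :: "real poly"
  shows "(\<lambda>t. poly q t) has_fps_expansion fps_of_poly q"
proof (induction q)
  case 0
  then show ?case by simp
next
  case (pCons c q)
  have "(\<lambda>t. c + poly q t * t) has_fps_expansion (fps_const c + fps_of_poly q * fps_X)"
    by (intro fps_expansion_intros pCons.IH)
  then show ?case
    by (simp add: fps_of_poly_pCons mult.commute)
qed

lemma bigo_of_fps_expansion:
  fixes h :: "real \<Rightarrow> real"
  assumes G: "h has_fps_expansion G" and low: "\<And>k. k < n \<Longrightarrow> fps_nth G k = 0"
  shows "h \<in> O[at 0](\<lambda>t. t ^ n)"
proof (cases "G = 0")
  case True
  then have "\<forall>\<^sub>F t in nhds 0. h t = 0"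
    using G by (simp add: has_fps_expansion_0_iff)
  then have "\<forall>\<^sub>F t in at 0. h t = 0"
    by (rule filter_leD[OF at_within_le_nhds])
  then show ?thesis
    by (intro bigoI[of _ 0]) (auto elim: eventually_mono)
next
  case False
  then have "n \<le> subdegree G"
    using low by (metis leI nth_subdegree_nonzero)
  define g where "g = (\<lambda>t. if t = 0 then fps_nth G n else h t / t ^ n)"
  have "g has_fps_expansion fps_shift n G"
    unfolding g_def by (rule has_fps_expansion_shift[OF G \<open>n \<le> subdegree G\<close>]) simp
  then have "isCont g 0"
    by (rule has_fps_expansion_imp_continuous)
  then have "(g \<longlongrightarrow> g 0) (at 0)"
    by (rule isContD)
  moreover have "\<forall>\<^sub>F t in at 0. g t = h t / t ^ n"
    using eventually_neq_at_within[of 0] by eventually_elim (simp add: g_def)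
  ultimately have "((\<lambda>t. h t / t ^ n) \<longlongrightarrow> g 0) (at 0)"
    by (rule Lim_transform_eventually)
  moreover have "\<forall>\<^sub>F t in at 0. t ^ n \<noteq> (0 :: real)"
    using eventually_neq_at_within[of 0] by eventually_elim simp
  ultimately show ?thesis
    by (rule bigoI_tendsto)
qed

text \<open>The matrix \<open>A + X B\<close> over the polynomial ring. Its characteristic polynomial specialises to that
  of \<open>A + t B\<close> for real \<open>t\<close>, extends it to complex \<open>t\<close>, and maps to that of the formal pencil over
  power series.\<close>

definition pencil :: "nat \<Rightarrow> real mat \<Rightarrow> real mat \<Rightarrow> real poly mat" where
  "pencil n A B = mat n n (\<lambda>(i, j). [:A $$ (i, j), B $$ (i, j):])"

lemma pencil_carrier [simp]: "pencil n A B \<in> carrier_mat n n"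
  by (simp add: pencil_def)

interpretation fps_of_poly_hom: comm_ring_hom "fps_of_poly :: real poly \<Rightarrow> real fps"
  by unfold_locales (simp_all add: fps_of_poly_add fps_of_poly_mult)

lemma char_poly_pencil_eval:
  assumes "A \<in> carrier_mat n n" and "B \<in> carrier_mat n n"
  shows "char_poly (A + t \<cdot>\<^sub>m B) = map_poly (\<lambda>q. poly q t) (char_poly (pencil n A B))"
proof -
  have "A + t \<cdot>\<^sub>m B = map_mat (\<lambda>q. poly q t) (pencil n A B)"
    by (rule eq_matI) (use assms in \<open>auto simp: pencil_def\<close>)
  then show ?thesis
    by (simp only: poly_hom.char_poly_hom[OF pencil_carrier])
qed

lemma symmetric_pencil_splits:
  assumes "A \<in> sym_mats n" and "B \<in> sym_mats n"
  shows "\<exists>m. analytic_splitting_at n (\<lambda>t. char_poly (A + t \<cdot>\<^sub>m B)) m x"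
proof -
  have A: "A \<in> carrier_mat n n" and B: "B \<in> carrier_mat n n"
    using assms by (simp_all add: sym_mats_def)
  define Q where "Q = char_poly (pencil n A B)"
  define ev where "ev = (\<lambda>z (q :: real poly). poly (map_poly complex_of_real q) z)"
  define p where "p = (\<lambda>z. map_poly (ev z) Q)"
  have Q: "degree Q = n" "coeff Q n = 1"
    using degree_monic_char_poly[OF pencil_carrier] by (simp_all add: Q_def)
  have p_coeff: "coeff (p z) j = ev z (coeff Q j)" for z j
    by (simp add: p_def coeff_map_poly ev_def)
  have real_point: "p (of_real t) = map_poly of_real (char_poly (A + t \<cdot>\<^sub>m B))" for t
    by (rule poly_eqI)
      (simp add: p_coeff char_poly_pencil_eval[OF A B] coeff_map_poly ev_def Q_def)
  have sym: "A + t \<cdot>\<^sub>m B \<in> sym_mats n" for t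
  proof -
    have "transpose_mat (A + t \<cdot>\<^sub>m B) = transpose_mat A + t \<cdot>\<^sub>m transpose_mat B"
      by (rule eq_matI) (use A B in auto)
    then show ?thesis
      using assms by (simp add: sym_mats_def)
  qed
  show ?thesis
  proof (rule analytic_splitting_at_real_point)
    show "degree (p z) \<le> n" for z
      unfolding p_def using degree_map_poly_le[of "ev z" Q] Q(1) by simp
    show "coeff (p z) n = 1" for z
      by (simp add: p_coeff Q(2) ev_def)
    show "(\<lambda>z. coeff (p z) j) analytic_on {z}" for z j
      unfolding p_coeff ev_def Polynomial.poly_altdef
      by (intro analytic_on_sum analytic_on_mult analytic_on_const analytic_on_power analytic_on_ident)
    show "poly (p (of_real t)) (of_real y) = of_real (poly (char_poly (A + t \<cdot>\<^sub>m B)) y)" for t y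
      by (simp add: real_point)
    show "y \<in> \<real>" if "poly (p (of_real t)) y = 0" for t y
      using char_poly_root_real[OF sym] that by (simp add: real_point)
  qed
qed

text \<open>The expansion \<open>F\<close> of an analytic eigenvalue is a root of the characteristic polynomial of
  \<open>A + X B\<close> over formal power series, hence it has a formal eigenvector, to which
  \<open>formal_eigenvalue_subdegree\<close> applies.\<close>

lemma psd_pencil_eigenvalue_subdegree:
  assumes A: "A \<in> psd_mats n" and B: "B \<in> sym_mats n"
    and F: "f has_fps_expansion F" and "F \<noteq> 0"
    and root: "\<forall>\<^sub>F t in nhds 0. poly (char_poly (A + t \<cdot>\<^sub>m B)) (f t) = 0"
  shows "subdegree F \<le> 2"
proof -
  have Ac: "A \<in> carrier_mat n n" and Bc: "B \<in> carrier_mat n n"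
    using A B by (simp_all add: psd_mats_def sym_mats_def)
  define Q where "Q = char_poly (pencil n A B)"
  have Qn: "degree Q = n"
    using degree_monic_char_poly[OF pencil_carrier] by (simp add: Q_def)
  have "(\<lambda>t. \<Sum>j\<le>n. poly (coeff Q j) t * f t ^ j) has_fps_expansion
      (\<Sum>j\<le>n. fps_of_poly (coeff Q j) * F ^ j)"
    by (intro has_fps_expansion_sum has_fps_expansion_mult has_fps_expansion_power
        has_fps_expansion_poly F)
  moreover have "\<forall>\<^sub>F t in nhds 0. (\<Sum>j\<le>n. poly (coeff Q j) t * f t ^ j) = 0"
    using root
  proof eventually_elim
    case (elim t)
    have "degree (char_poly (A + t \<cdot>\<^sub>m B)) \<le> n"
      using degree_monic_char_poly[of "A + t \<cdot>\<^sub>m B" n] Ac Bc by simp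
    then have "poly (char_poly (A + t \<cdot>\<^sub>m B)) (f t)
        = (\<Sum>j\<le>n. coeff (char_poly (A + t \<cdot>\<^sub>m B)) j * f t ^ j)"
      by (rule poly_sum_upto)
    then show ?case
      using elim by (simp add: char_poly_pencil_eval[OF Ac Bc] coeff_map_poly Q_def)
  qed
  then have "\<forall>\<^sub>F t in at 0. (\<Sum>j\<le>n. poly (coeff Q j) t * f t ^ j) = 0"
    by (rule filter_leD[OF at_within_le_nhds])
  ultimately have "(\<Sum>j\<le>n. fps_of_poly (coeff Q j) * F ^ j) = 0"
    by (rule fps_expansion_zero_real)
  moreover have "poly (map_poly fps_of_poly Q) F = (\<Sum>j\<le>n. fps_of_poly (coeff Q j) * F ^ j)"
  proof -
    have "degree (map_poly fps_of_poly Q) \<le> n"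
      using degree_map_poly_le[of fps_of_poly Q] Qn by simp
    from poly_sum_upto[OF this] show ?thesis
      by (simp add: coeff_map_poly)
  qed
  ultimately have "poly (char_poly (map_mat fps_of_poly (pencil n A B))) F = 0"
    by (simp add: fps_of_poly_hom.char_poly_hom[OF pencil_carrier] Q_def)
  from char_poly_root_imp_kernel_vector[OF _ this, of n] obtain w
    where w: "\<exists>i<n. w i \<noteq> 0"
      and eig: "\<And>i. i < n \<Longrightarrow> (\<Sum>j<n. map_mat fps_of_poly (pencil n A B) $$ (i, j) * w j) = F * w i"
    by auto
  obtain m u where u: "\<And>i. i < n \<Longrightarrow> w i = fps_X ^ m * u i" "\<exists>i<n. fps_nth (u i) 0 \<noteq> 0"
    using formal_vector_primitive_part[OF w] by blast
  define c where "c = (\<lambda>i j. fps_const (A $$ (i, j)) + fps_const (B $$ (i, j)) * fps_X)"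
  have eig': "(\<Sum>j<n. c i j * u j) = F * u i" if "i < n" for i
  proof -
    have "fps_X ^ m * (\<Sum>j<n. c i j * u j) = (\<Sum>j<n. map_mat fps_of_poly (pencil n A B) $$ (i, j) * w j)"
      unfolding sum_distrib_left
      by (intro sum.cong refl) (use that in \<open>simp add: u(1) c_def pencil_def fps_of_poly_pCons mult_ac\<close>)
    also have "\<dots> = fps_X ^ m * (F * u i)"
      using eig[OF that] u(1)[OF that] by (simp add: mult_ac)
    finally show ?thesis
      by simp
  qed
  obtain i0 where "i0 < n" "fps_nth (u i0) 0 \<noteq> 0"
    using u(2) by blast
  show ?thesis
  proof (rule formal_eigenvalue_subdegree[of n "\<lambda>i j. A $$ (i, j)" "\<lambda>i j. B $$ (i, j)" u F i0])
    show "A $$ (i, j) = A $$ (j, i)" if "i < n" "j < n" for i j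
      using sym_mats_entries[of A n i j] A that by (simp add: psd_mats_def)
    show "B $$ (i, j) = B $$ (j, i)" if "i < n" "j < n" for i j
      using sym_mats_entries[OF B that] .
    show "0 \<le> (\<Sum>i<n. x i * (\<Sum>j<n. A $$ (i, j) * x j))" for x
    proof -
      have "(vec n x) \<bullet> (A *\<^sub>v vec n x) = (\<Sum>i<n. x i * (\<Sum>j<n. A $$ (i, j) * x j))"
        using Ac by (simp add: scalar_prod_def atLeast0LessThan)
      moreover have "0 \<le> (vec n x) \<bullet> (A *\<^sub>v vec n x)"
        using A by (simp add: psd_mats_def)
      ultimately show ?thesis
        by simp
    qed
    show "(\<Sum>j<n. (fps_const (A $$ (i, j)) + fps_const (B $$ (i, j)) * fps_X) * u j) = F * u i" if "i < n" for i
      using eig'[OF that] by (simp only: c_def)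
  qed fact+
qed

theorem theorem4p2:
  fixes n :: nat and A B :: "real mat"
  assumes "A \<in> psd_mats n" and "B \<in> sym_mats n"
  shows "\<exists>l :: nat \<Rightarrow> real \<Rightarrow> real.
           (\<forall>i<n. real_analytic (l i)) \<and>
           (\<forall>t. eigenvalues_with_mult n (A + t \<cdot>\<^sub>m B) (\<lambda>i. l i t)) \<and>
           (\<forall>i<n. (\<exists>t. l i t \<noteq> 0) \<longrightarrow>
              (\<exists>\<sigma> d. \<sigma> \<noteq> 0 \<and> d \<in> {0, 1, 2} \<and> has_leading_term (l i) \<sigma> d \<and>
                 (\<lambda>t. l i t - \<sigma> * t ^ d) \<in> O[at 0](\<lambda>t. t ^ (d + 1))))"
proof -
  have A: "A \<in> sym_mats n"
    using assms(1) by (simp add: psd_mats_def)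
  obtain l where an: "\<And>i x. i < n \<Longrightarrow> real_analytic_at (l i) x"
    and split: "\<And>t. char_poly (A + t \<cdot>\<^sub>m B) = (\<Prod>i<n. [:- l i t, 1:])"
    using global_analytic_splitting[OF symmetric_pencil_splits[OF A assms(2)]] by blast
  have carrier: "A + t \<cdot>\<^sub>m B \<in> carrier_mat n n" for t
    using A assms(2) by (simp add: sym_mats_def)
  have "real_analytic (l i)" if "i < n" for i
    using real_analytic_at_imp_has_fps_expansion[OF an[OF that]] by (simp add: real_analytic_def)
  moreover have "eigenvalues_with_mult n (A + t \<cdot>\<^sub>m B) (\<lambda>i. l i t)" for t
    unfolding eigenvalues_with_mult_def eigenvalue_root_char_poly[OF carrier] split poly_split
    by auto
  moreover have "\<exists>\<sigma> d. \<sigma> \<noteq> 0 \<and> d \<in> {0, 1, 2} \<and> has_leading_term (l i) \<sigma> d \<and>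
      (\<lambda>t. l i t - \<sigma> * t ^ d) \<in> O[at 0](\<lambda>t. t ^ (d + 1))"
    if i: "i < n" and nz: "\<exists>t. l i t \<noteq> 0" for i
  proof -
    obtain F where F: "l i has_fps_expansion F"
      using real_analytic_at_imp_has_fps_expansion[OF an[OF i], of 0] by auto
    have "F \<noteq> 0"
    proof
      assume "F = 0"
      then have "\<forall>\<^sub>F t in nhds 0. l i t = 0"
        using F by (simp add: has_fps_expansion_0_iff)
      then have "l i t = 0" for t
        by (rule real_analytic_identity[OF an[OF i]])
      then show False
        using nz by simp
    qed
    define d where "d = subdegree F"
    define \<sigma> where "\<sigma> = fps_nth F d"
    have "poly (char_poly (A + t \<cdot>\<^sub>m B)) (l i t) = 0" for t
      unfolding split poly_split using i by (intro prod_zero) auto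
    then have "d \<le> 2"
      unfolding d_def by (intro psd_pencil_eigenvalue_subdegree[OF assms F \<open>F \<noteq> 0\<close>]) simp
    then have "d \<in> {0, 1, 2}"
      by auto
    moreover have "\<sigma> \<noteq> 0"
      using \<open>F \<noteq> 0\<close> by (simp add: \<sigma>_def d_def)
    moreover have "has_leading_term (l i) \<sigma> d"
      using F \<open>F \<noteq> 0\<close> by (auto simp: has_leading_term_def \<sigma>_def d_def)
    moreover have "(\<lambda>t. l i t - \<sigma> * t ^ d) \<in> O[at 0](\<lambda>t. t ^ (d + 1))"
    proof (rule bigo_of_fps_expansion)
      show "(\<lambda>t. l i t - \<sigma> * t ^ d) has_fps_expansion (F - fps_const \<sigma> * fps_X ^ d)"
        by (intro fps_expansion_intros F)
      show "fps_nth (F - fps_const \<sigma> * fps_X ^ d) k = 0" if "k < d + 1" for k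
        using that nth_less_subdegree_zero[of k F] by (cases "k = d") (auto simp: \<sigma>_def d_def)
    qed
    ultimately show ?thesis
      by blast
  qed
  ultimately show ?thesis
    by blast
qed

end
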